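(* Let $q\ge 3$ be a prime power and $\ell\ge 2$ an integer, and let $t_\ell(q):=\frac{q^\ell-1}{q-1}$. Then for every integer $n$ satisfying $$\min\{2t_\ell(q),\,3t_\ell(q)-6\}\le n\le q^\ell+1,$$ there exists an $(n,n-2,\ell)$ MDS array code $\mathcal{C}$ over $\mathbb{F}_q$ such that $$\beta_{\mathrm{avg}}(\mathcal{C})=\beta_{\max}(\mathcal{C})=\gamma_{\mathrm{avg}}(\mathcal{C})=\gamma_{\max}(\mathcal{C})=\ell(n-1)-t_\ell(q),$$ where these quantities are the average and worst-case repair bandwidth and the average and worst-case repair I/O of $\mathcal{C}$ under linear exact repair.
   Context: Write $[n]=\{1,\dots,n\}$. An $(n,k,\ell)$ linear array code over $\mathbb{F}_q$ is an $\mathbb{F}_q$-subspace $\mathcal{C}\le(\mathbb{F}_q^\ell)^n$ of dimension $k\ell$; here $1\le k<n$ and $r:=n-k$ (so $r=2$ when $k=n-2$). It is described by a block parity-check matrix $H=[H_1\ H_2\ \cdots\ H_n]\in\mathbb{F}_q^{r\ell\times n\ell}$ of full row rank $r\ell$, with $H_i\in\mathbb{F}_q^{r\ell\times\ell}$, so that $\mathcal{C}=\{(C_1,\dots,C_n)\in(\mathbb{F}_q^\ell)^n:\sum_{i=1}^n H_iC_i=0\}$. The code is MDS if for every $I\subseteq[n]$ with $|I|=r$ the square matrix $[H_i]_{i\in I}\in\mathbb{F}_q^{r\ell\times r\ell}$ is invertible. For $i\in[n]$ let $\mathcal{M}_i=\{M\in\mathbb{F}_q^{\ell\times r\ell}: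 MH_i\text{ is invertible}\}$ (the linear repair matrices for node $i$). For $M\in\mathcal{M}_i$ put $\mathrm{BW}_i(M)=\sum_{j\ne i}\mathrm{rank}(MH_j)$ and $\mathrm{IO}_i(M)=\sum_{j\ne i}\mathrm{nz}(MH_j)$, where $\mathrm{nz}(A)$ is the number of nonzero columns of $A$. Define $\beta_i(\mathcal{C})=\min_{M\in\mathcal{M}_i}\mathrm{BW}_i(M)$, $\gamma_i(\mathcal{C})=\min_{M\in\mathcal{M}_i}\mathrm{IO}_i(M)$, and $\beta_{\mathrm{avg}}(\mathcal{C})=\frac1n\sum_{i=1}^n\beta_i(\mathcal{C})$, $\beta_{\max}(\mathcal{C})=\max_{i\in[n]}\beta_i(\mathcal{C})$, $\gamma_{\mathrm{avg}}(\mathcal{C})=\frac1n\sum_{i=1}^n\gamma_i(\mathcal{C})$, $\gamma_{\max}(\mathcal{C})=\max_{i\in[n]}\gamma_i(\mathcal{C})$. (These do not depend on the choice of $H$, since $H$ is determined by $\mathcal{C}$ up to left multiplication by an invertible matrix.) *)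

theory Defs
  imports "HOL-Library.Cardinality" "Jordan_Normal_Form.DL_Rank" "Jordan_Normal_Form.DL_Submatrix"
    "Jordan_Normal_Form.Matrix_Kernel"
begin

text \<open>
  Conventions: the field with \<open>q\<close> elements is a type of class \<open>{finite, field}\<close> with
  \<open>CARD('a) = q\<close>. Nodes are numbered \<open>0, \<dots>, n - 1\<close>. A word \<open>(C\<^sub>0, \<dots>, C\<^sub>n\<^sub>-\<^sub>1)\<close> with blocks
  of length \<open>l\<close> is the concatenated vector of length \<open>n * l\<close>, so coordinate \<open>i * l + a\<close> is entry
  \<open>a\<close> of block \<open>i\<close>, and a block matrix \<open>[H\<^sub>0 \<dots> H\<^sub>n\<^sub>-\<^sub>1]\<close> is a matrix with \<open>n * l\<close> columns.
  In particular \<open>H *\<^sub>v c\<close> is the sum of the products \<open>H\<^sub>i C\<^sub>i\<close>.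
\<close>

definition mat_rank :: "'a::field mat \<Rightarrow> nat" where
  "mat_rank A = vec_space.rank (dim_row A) A"

definition nonzero_cols :: "'a::zero mat \<Rightarrow> nat" where
  "nonzero_cols A = card {j. j < dim_col A \<and> col A j \<noteq> 0\<^sub>v (dim_row A)}"

definition block :: "nat \<Rightarrow> 'a mat \<Rightarrow> nat \<Rightarrow> 'a mat" where
  "block l H i = mat (dim_row H) l (\<lambda>(a, b). H $$ (a, i * l + b))"

definition block_cols :: "nat \<Rightarrow> 'a mat \<Rightarrow> nat set \<Rightarrow> 'a mat" where
  "block_cols l H I = submatrix H UNIV {c. c div l \<in> I}"


definition linear_array_code :: "nat \<Rightarrow> nat \<Rightarrow> nat \<Rightarrow> 'a::field vec set \<Rightarrow> bool" where
  "linear_array_code n k l C \<longleftrightarrow> 1 \<le> k \<and> k < n \<and>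
     VectorSpace.subspace class_ring C (module_vec TYPE('a) (n * l)) \<and>
     vectorspace.dim class_ring (module_vec TYPE('a) (n * l) \<lparr>carrier := C\<rparr>) = k * l"

definition parity_check :: "nat \<Rightarrow> nat \<Rightarrow> nat \<Rightarrow> 'a::field vec set \<Rightarrow> 'a mat \<Rightarrow> bool" where
  "parity_check n k l C H \<longleftrightarrow> H \<in> carrier_mat ((n - k) * l) (n * l) \<and>
     mat_rank H = (n - k) * l \<and> C = mat_kernel H"

definition parity_check_mat :: "nat \<Rightarrow> nat \<Rightarrow> nat \<Rightarrow> 'a::field vec set \<Rightarrow> 'a mat" where
  "parity_check_mat n k l C = (SOME H. parity_check n k l C H)"


text \<open>The following notions are relative to a block parity-check matrix \<open>H\<close>, with \<open>r = n - k\<close>.\<close>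

definition mds_matrix :: "nat \<Rightarrow> nat \<Rightarrow> nat \<Rightarrow> 'a::field mat \<Rightarrow> bool" where
  "mds_matrix n r l H \<longleftrightarrow>
     (\<forall>I. I \<subseteq> {..<n} \<and> card I = r \<longrightarrow> invertible_mat (block_cols l H I))"

definition repair_mats :: "nat \<Rightarrow> nat \<Rightarrow> 'a::field mat \<Rightarrow> nat \<Rightarrow> 'a mat set" where
  "repair_mats r l H i = {M \<in> carrier_mat l (r * l). invertible_mat (M * block l H i)}"

definition repair_bw :: "nat \<Rightarrow> nat \<Rightarrow> 'a::field mat \<Rightarrow> nat \<Rightarrow> 'a mat \<Rightarrow> nat" where
  "repair_bw n l H i M = (\<Sum>j\<in>{..<n} - {i}. mat_rank (M * block l H j))"

definition repair_io :: "nat \<Rightarrow> nat \<Rightarrow> 'a::field mat \<Rightarrow> nat \<Rightarrow> 'a mat \<Rightarrow> nat" where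
  "repair_io n l H i M = (\<Sum>j\<in>{..<n} - {i}. nonzero_cols (M * block l H j))"

definition min_repair_bw :: "nat \<Rightarrow> nat \<Rightarrow> nat \<Rightarrow> 'a::field mat \<Rightarrow> nat \<Rightarrow> nat" where
  "min_repair_bw n r l H i = Min (repair_bw n l H i ` repair_mats r l H i)"

definition min_repair_io :: "nat \<Rightarrow> nat \<Rightarrow> nat \<Rightarrow> 'a::field mat \<Rightarrow> nat \<Rightarrow> nat" where
  "min_repair_io n r l H i = Min (repair_io n l H i ` repair_mats r l H i)"


text \<open>
  The corresponding notions for a code are evaluated at an arbitrarily chosen parity-check matrix.
  By \<open>parity_check_independent\<close> below, the choice does not matter.
\<close>

definition mds :: "nat \<Rightarrow> nat \<Rightarrow> nat \<Rightarrow> 'a::field vec set \<Rightarrow> bool" where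
  "mds n k l C \<longleftrightarrow> mds_matrix n (n - k) l (parity_check_mat n k l C)"

definition beta :: "nat \<Rightarrow> nat \<Rightarrow> nat \<Rightarrow> 'a::field vec set \<Rightarrow> nat \<Rightarrow> nat" where
  "beta n k l C i = min_repair_bw n (n - k) l (parity_check_mat n k l C) i"

definition gamma :: "nat \<Rightarrow> nat \<Rightarrow> nat \<Rightarrow> 'a::field vec set \<Rightarrow> nat \<Rightarrow> nat" where
  "gamma n k l C i = min_repair_io n (n - k) l (parity_check_mat n k l C) i"

definition beta_avg :: "nat \<Rightarrow> nat \<Rightarrow> nat \<Rightarrow> 'a::field vec set \<Rightarrow> real" where
  "beta_avg n k l C = (\<Sum>i<n. real (beta n k l C i)) / real n"

definition beta_max :: "nat \<Rightarrow> nat \<Rightarrow> nat \<Rightarrow> 'a::field vec set \<Rightarrow> nat" where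
  "beta_max n k l C = Max (beta n k l C ` {..<n})"

definition gamma_avg :: "nat \<Rightarrow> nat \<Rightarrow> nat \<Rightarrow> 'a::field vec set \<Rightarrow> real" where
  "gamma_avg n k l C = (\<Sum>i<n. real (gamma n k l C i)) / real n"

definition gamma_max :: "nat \<Rightarrow> nat \<Rightarrow> nat \<Rightarrow> 'a::field vec set \<Rightarrow> nat" where
  "gamma_max n k l C = Max (gamma n k l C ` {..<n})"

definition t_num :: "nat \<Rightarrow> nat \<Rightarrow> real" where
  "t_num l q = (real q ^ l - 1) / (real q - 1)"


lemma full_row_rank_right_inverse:
  fixes H :: "'a::field mat"
  assumes H: "H \<in> carrier_mat m N" and rk: "mat_rank H = m"
  shows "\<exists>B \<in> carrier_mat N m. H * B = 1\<^sub>m m"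
proof -
  interpret vec_space "TYPE('a)" m .
  have colsH: "set (cols H) \<subseteq> carrier_vec m"
    using H cols_dim by blast
  have rk': "rank H = m"
    using rk H by (simp add: mat_rank_def)
  have li0: "lin_indpt {}"
    unfolding lin_dep_def by simp
  obtain S where S: "maximal S (\<lambda>T. T \<subseteq> set (cols H) \<and> lin_indpt T)"
    using maximal_exists_superset[of "set (cols H)" "\<lambda>T. T \<subseteq> set (cols H) \<and> lin_indpt T" "{}"]
      li0 by auto
  have "card S = m"
    using rank_card_indpt[OF H S] rk' by simp
  have Sc: "S \<subseteq> set (cols H)" "lin_indpt S"
    using S by (auto simp: maximal_def)
  have fS: "finite S"
    using Sc(1) finite_subset by blast
  have "basis S"
    using Sc colsH \<open>card S = m\<close> fS by (intro dim_li_is_basis) (auto simp: dim_is_n)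
  then have "span S = carrier_vec m"
    by (simp add: basis_def)
  then have "col_space H = carrier_vec m"
    unfolding col_space_def using span_is_monotone[OF Sc(1)] colsH span_closed by blast
  then have "\<forall>j. \<exists>x. j < m \<longrightarrow> x \<in> carrier_vec N \<and> H *\<^sub>v x = unit_vec m j"
    using col_space_eq[OF H] H unit_vec_carrier by blast
  then obtain x where x: "\<And>j. j < m \<Longrightarrow> x j \<in> carrier_vec N \<and> H *\<^sub>v x j = unit_vec m j"
    by metis
  define B where "B = mat N m (\<lambda>(i, j). x j $ i)"
  have B: "B \<in> carrier_mat N m"
    by (simp add: B_def)
  have colB: "col B j = x j" if "j < m" for j
    using x[OF that] that by (intro eq_vecI) (auto simp: B_def)
  have "col (H * B) j = col (1\<^sub>m m) j" if "j < m" for j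
    using x[OF that] H B that by (simp add: col_mult2[OF H B that] colB)
  then have "H * B = 1\<^sub>m m"
    using H B by (intro mat_col_eqI) auto
  then show ?thesis
    using B by blast
qed

lemma same_kernel_factor:
  fixes H H' :: "'a::field mat"
  assumes H: "H \<in> carrier_mat m N" and H': "H' \<in> carrier_mat m N"
    and B: "B \<in> carrier_mat N m" and HB: "H * B = 1\<^sub>m m"
    and ker: "mat_kernel H = mat_kernel H'"
  shows "H' = (H' * B) * H"
proof (rule mat_col_eqI)
  have c: "H' * B * H \<in> carrier_mat m N"
    using H H' B by simp
  then show "dim_row H' = dim_row (H' * B * H)" "dim_col H' = dim_col (H' * B * H)"
    using H' by auto
  fix j assume "j < dim_col (H' * B * H)"
  then have j: "j < N"
    using H by simp
  define e where "e = (unit_vec N j :: 'a vec)"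
  have e: "e \<in> carrier_vec N"
    by (simp add: e_def)
  define w where "w = e - B *\<^sub>v (H *\<^sub>v e)"
  have He: "H *\<^sub>v e \<in> carrier_vec m"
    using H e by simp
  have w: "w \<in> carrier_vec N"
    using B He e by (simp add: w_def)
  have "H *\<^sub>v (B *\<^sub>v (H *\<^sub>v e)) = H *\<^sub>v e"
    using assoc_mult_mat_vec[OF H B He] HB He by simp
  then have "H *\<^sub>v w = 0\<^sub>v m"
    unfolding w_def using mult_minus_distrib_mat_vec[OF H e, of "B *\<^sub>v (H *\<^sub>v e)"] B He by simp
  then have "w \<in> mat_kernel H'"
    using mat_kernelI[OF H w] ker by simp
  then have "H' *\<^sub>v w = 0\<^sub>v m"
    using mat_kernelD[OF H'] by simp
  then have diff: "H' *\<^sub>v e - H' *\<^sub>v (B *\<^sub>v (H *\<^sub>v e)) = 0\<^sub>v m"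
    unfolding w_def using mult_minus_distrib_mat_vec[OF H' e, of "B *\<^sub>v (H *\<^sub>v e)"] B He by simp
  have eq: "a = b"
    if d: "a - b = 0\<^sub>v m" and a: "a \<in> carrier_vec m" and b: "b \<in> carrier_vec m" for a b :: "'a vec"
  proof (rule eq_vecI)
    fix i assume "i < dim_vec b"
    then have i: "i < m"
      using b by simp
    have "(a - b) $ i = 0"
      unfolding d using i by simp
    then show "a $ i = b $ i"
      using index_minus_vec(1)[of i b a] i b by simp
  next
    show "dim_vec a = dim_vec b"
      using a b by simp
  qed
  have "H' *\<^sub>v e = H' *\<^sub>v (B *\<^sub>v (H *\<^sub>v e))"
    by (rule eq[OF diff]) (use H' B He e in auto)
  also have "\<dots> = (H' * B * H) *\<^sub>v e"
    using H H' B He e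
    by (metis assoc_mult_mat_vec mult_carrier_mat)
  finally have "H' *\<^sub>v e = (H' * B * H) *\<^sub>v e" .
  moreover have "A *\<^sub>v e = col A j" if "A \<in> carrier_mat m N" for A :: "'a mat"
    using that j by (intro eq_vecI) (auto simp: e_def)
  ultimately show "col H' j = col (H' * B * H) j"
    using H' c by simp
qed

lemma parity_check_row_equivalent:
  fixes H H' :: "'a::field mat"
  assumes "parity_check n k l C H" and "parity_check n k l C H'"
  defines "m \<equiv> (n - k) * l"
  shows "\<exists>P \<in> carrier_mat m m. \<exists>Q \<in> carrier_mat m m.
    P * Q = 1\<^sub>m m \<and> Q * P = 1\<^sub>m m \<and> H' = P * H"
proof -
  have H: "H \<in> carrier_mat m (n * l)" "mat_rank H = m"
    and H': "H' \<in> carrier_mat m (n * l)" "mat_rank H' = m"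
    and ker: "mat_kernel H = mat_kernel H'"
    using assms by (auto simp: parity_check_def)
  obtain B where B: "B \<in> carrier_mat (n * l) m" "H * B = 1\<^sub>m m"
    using full_row_rank_right_inverse[OF H] by blast
  obtain B' where B': "B' \<in> carrier_mat (n * l) m" "H' * B' = 1\<^sub>m m"
    using full_row_rank_right_inverse[OF H'] by blast
  define P Q where "P = H' * B" and "Q = H * B'"
  have P: "P \<in> carrier_mat m m" and Q: "Q \<in> carrier_mat m m"
    using H H' B B' by (auto simp: P_def Q_def)
  have 1: "H' = P * H"
    unfolding P_def by (rule same_kernel_factor[OF H(1) H'(1) B ker])
  have 2: "H = Q * H'"
    unfolding Q_def by (rule same_kernel_factor[OF H'(1) H(1) B' ker[symmetric]])
  have "P * Q = 1\<^sub>m m"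
    unfolding Q_def using 1 assoc_mult_mat[OF P H(1) B'(1)] B'(2) by simp
  moreover have "Q * P = 1\<^sub>m m"
    unfolding P_def using 2 assoc_mult_mat[OF Q H'(1) B(1)] B(2) by simp
  ultimately show ?thesis
    using P Q 1 by blast
qed

lemma block_mult:
  fixes H P :: "'a::field mat"
  assumes P: "P \<in> carrier_mat m m" and H: "H \<in> carrier_mat m (n * l)" and i: "i < n"
  shows "block l (P * H) i = P * block l H i"
proof (rule eq_matI)
  fix a b assume ab: "a < dim_row (P * block l H i)" "b < dim_col (P * block l H i)"
  have b: "b < l" and a: "a < m"
    using ab P by (auto simp: block_def)
  have "i * l + b < Suc i * l"
    using b by simp
  also have "Suc i * l \<le> n * l"
    using i by (intro mult_le_mono1) simp
  finally have ib: "i * l + b < n * l" .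
  have "col (block l H i) b = col H (i * l + b)"
    using b ib H by (intro eq_vecI) (auto simp: block_def)
  then show "block l (P * H) i $$ (a, b) = (P * block l H i) $$ (a, b)"
    using a b ib P H by (simp add: block_def)
qed (use P H in \<open>auto simp: block_def\<close>)

lemma block_cols_mult:
  fixes H P :: "'a::field mat"
  assumes P: "P \<in> carrier_mat m m" and H: "H \<in> carrier_mat m N"
  shows "block_cols l (P * H) I = P * block_cols l H I"
proof (rule eq_matI)
  let ?J = "{c. c div l \<in> I}"
  fix a b assume ab: "a < dim_row (P * block_cols l H I)" "b < dim_col (P * block_cols l H I)"
  have b: "b < card {j. j < N \<and> j \<in> ?J}" and a: "a < m"
    using ab P H by (auto simp: block_cols_def dim_submatrix)
  have pb: "pick ?J b < N"
    using b by (rule pick_le)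
  have "col (block_cols l H I) b = col H (pick ?J b)"
    using b pb H by (intro eq_vecI) (auto simp: block_cols_def submatrix_def pick_UNIV)
  then show "block_cols l (P * H) I $$ (a, b) = (P * block_cols l H I) $$ (a, b)"
    using a b pb P H by (simp add: block_cols_def submatrix_def pick_UNIV)
qed (use P H in \<open>auto simp: block_cols_def dim_submatrix\<close>)

lemma invertible_mat_mult_left:
  fixes A P Q :: "'a::field mat"
  assumes P: "P \<in> carrier_mat m m" and Q: "Q \<in> carrier_mat m m"
    and PQ: "P * Q = 1\<^sub>m m" and QP: "Q * P = 1\<^sub>m m"
    and r: "dim_row A = m" and A: "invertible_mat A"
  shows "invertible_mat (P * A)"
proof -
  have A': "A \<in> carrier_mat m m"
    using A r by (auto simp: invertible_mat_def)
  obtain R where R: "A * R = 1\<^sub>m m" "R * A = 1\<^sub>m (dim_row R)"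
    using A A' by (auto simp: invertible_mat_def inverts_mat_def)
  have R': "R \<in> carrier_mat m m"
    using R A' by (metis carrier_matD(2) carrier_matI index_mult_mat(3) index_one_mat(3))
  have "P * A * (R * Q) = P * (A * R * Q)"
    using P Q A' R' by (simp add: assoc_mult_mat[of _ m m _ m _ m])
  then have 1: "P * A * (R * Q) = 1\<^sub>m m"
    using R PQ Q by simp
  have "R * Q * (P * A) = R * (Q * P * A)"
    using P Q A' R' by (simp add: assoc_mult_mat[of _ m m _ m _ m])
  then have 2: "R * Q * (P * A) = 1\<^sub>m m"
    using R R' QP A' by simp
  show ?thesis
    unfolding invertible_mat_def inverts_mat_def using 1 2 P A' R' by auto
qed

lemma mds_matrix_mult:
  fixes H P Q :: "'a::field mat"
  assumes P: "P \<in> carrier_mat (r * l) (r * l)" and Q: "Q \<in> carrier_mat (r * l) (r * l)"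
    and PQ: "P * Q = 1\<^sub>m (r * l)" and QP: "Q * P = 1\<^sub>m (r * l)"
    and H: "H \<in> carrier_mat (r * l) (n * l)" and mds: "mds_matrix n r l H"
  shows "mds_matrix n r l (P * H)"
  using mds H unfolding mds_matrix_def block_cols_mult[OF P H]
  by (auto intro!: invertible_mat_mult_left[OF P Q PQ QP] simp: block_cols_def dim_submatrix)

lemma repair_mult:
  fixes H P Q M :: "'a::field mat"
  assumes P: "P \<in> carrier_mat (r * l) (r * l)" and Q: "Q \<in> carrier_mat (r * l) (r * l)"
    and PQ: "P * Q = 1\<^sub>m (r * l)" and QP: "Q * P = 1\<^sub>m (r * l)"
    and H: "H \<in> carrier_mat (r * l) (n * l)" and i: "i < n"
    and M: "M \<in> repair_mats r l H i"
  shows "M * Q \<in> repair_mats r l (P * H) i"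
    and "repair_bw n l (P * H) i (M * Q) = repair_bw n l H i M"
    and "repair_io n l (P * H) i (M * Q) = repair_io n l H i M"
proof -
  have M': "M \<in> carrier_mat l (r * l)"
    using M by (simp add: repair_mats_def)
  have b: "block l H j \<in> carrier_mat (r * l) l" for j
    using H by (simp add: block_def)
  have *: "M * Q * block l (P * H) j = M * block l H j" if "j < n" for j
  proof -
    have "M * Q * (P * block l H j) = M * (Q * P * block l H j)"
      using M' P Q b[of j]
      by (simp add: assoc_mult_mat[of Q "r * l" "r * l" P "r * l" _ l]
          assoc_mult_mat[of M l "r * l" Q "r * l" _ l])
    then show ?thesis
      using block_mult[OF P H that] QP b[of j] by simp
  qed
  show "M * Q \<in> repair_mats r l (P * H) i"
    using M M' Q *[OF i] by (simp add: repair_mats_def)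
  show "repair_bw n l (P * H) i (M * Q) = repair_bw n l H i M"
    unfolding repair_bw_def by (intro sum.cong) (auto simp: *)
  show "repair_io n l (P * H) i (M * Q) = repair_io n l H i M"
    unfolding repair_io_def by (intro sum.cong) (auto simp: *)
qed

lemma repair_image_subset:
  fixes H H' :: "'a::field mat"
  assumes "parity_check n k l C H" and "parity_check n k l C H'" and i: "i < n"
  shows "repair_bw n l H i ` repair_mats (n - k) l H i
      \<subseteq> repair_bw n l H' i ` repair_mats (n - k) l H' i" (is ?bw)
    and "repair_io n l H i ` repair_mats (n - k) l H i
      \<subseteq> repair_io n l H' i ` repair_mats (n - k) l H' i" (is ?io)
proof -
  obtain P Q where PQ: "P \<in> carrier_mat ((n - k) * l) ((n - k) * l)"
      "Q \<in> carrier_mat ((n - k) * l) ((n - k) * l)"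
      "P * Q = 1\<^sub>m ((n - k) * l)" "Q * P = 1\<^sub>m ((n - k) * l)" and H': "H' = P * H"
    using parity_check_row_equivalent[OF assms(1,2)] by blast
  have H: "H \<in> carrier_mat ((n - k) * l) (n * l)"
    using assms(1) by (simp add: parity_check_def)
  note * = repair_mult[OF PQ H i, folded H']
  show ?bw ?io
    using *(1,2) *(1,3) by (force simp: image_iff)+
qed

lemma mds_matrix_transfer:
  fixes H H' :: "'a::field mat"
  assumes "parity_check n k l C H" and "parity_check n k l C H'"
    and "mds_matrix n (n - k) l H"
  shows "mds_matrix n (n - k) l H'"
proof -
  obtain P Q where PQ: "P \<in> carrier_mat ((n - k) * l) ((n - k) * l)"
      "Q \<in> carrier_mat ((n - k) * l) ((n - k) * l)"
      "P * Q = 1\<^sub>m ((n - k) * l)" "Q * P = 1\<^sub>m ((n - k) * l)" and H': "H' = P * H"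
    using parity_check_row_equivalent[OF assms(1,2)] by blast
  have "H \<in> carrier_mat ((n - k) * l) (n * l)"
    using assms(1) by (simp add: parity_check_def)
  then show ?thesis
    using mds_matrix_mult[OF PQ] assms(3) H' by simp
qed

lemma parity_check_independent:
  assumes H: "parity_check n k l C H"
  shows "mds n k l C \<longleftrightarrow> mds_matrix n (n - k) l H"
    and "i < n \<Longrightarrow> beta n k l C i = min_repair_bw n (n - k) l H i"
    and "i < n \<Longrightarrow> gamma n k l C i = min_repair_io n (n - k) l H i"
proof -
  have H0: "parity_check n k l C (parity_check_mat n k l C)"
    unfolding parity_check_mat_def using H by (rule someI)
  show "mds n k l C \<longleftrightarrow> mds_matrix n (n - k) l H"
    unfolding mds_def using mds_matrix_transfer[OF H H0] mds_matrix_transfer[OF H0 H] by blast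
  show "i < n \<Longrightarrow> beta n k l C i = min_repair_bw n (n - k) l H i"
    unfolding beta_def min_repair_bw_def
    using repair_image_subset(1)[OF H H0] repair_image_subset(1)[OF H0 H]
    by (metis subset_antisym)
  show "i < n \<Longrightarrow> gamma n k l C i = min_repair_io n (n - k) l H i"
    unfolding gamma_def min_repair_io_def
    using repair_image_subset(2)[OF H H0] repair_image_subset(2)[OF H0 H]
    by (metis subset_antisym)
qed

end

theory Submission
  imports Defs "HOL-Algebra.Algebraic_Closure_Type" "Jordan_Normal_Form.DL_Rank_Submatrix"
begin

text \<open>
  The column spaces of the blocks \<open>H\<^sub>j\<close> form a partial spread of \<open>l\<close>-dimensional subspaces
  of a \<open>2l\<close>-dimensional space, and a repair matrix is given by its \<open>l\<close>-dimensional kernel \<open>K\<close>.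
  Since \<open>K\<close> has only \<open>t = (q ^ l - 1) / (q - 1)\<close> points, at most \<open>t\<close> dimensions can be saved;
  they are saved, also in I/O, when every point of \<open>K\<close> is spanned by a column of some \<open>H\<^sub>j\<close>,
  \<open>j \<noteq> i\<close>.

  Take the Desarguesian spread, whose members are the points \<open>z\<close> of the projective line over the
  field with \<open>q ^ l\<close> elements. The kernel \<open>{(x, \<alpha> x + \<beta> x ^ q)}\<close> meets exactly the members
  on the circle of points \<open>z\<close> such that \<open>z - \<alpha>\<close> has the norm of \<open>\<beta>\<close>, in one point each. It suffices
  to find at most three circles without a common point whose union has at most \<open>n\<close> points:
  then every node avoids one of them, and at most two points need to be in the basis of a node.
  Two concentric circles need \<open>n \<ge> 2 t\<close>. The bound \<open>3 t - 6\<close> is smaller only for \<open>l = 2\<close> and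
  \<open>q = 3, 4\<close>, where there are three circles that pairwise share two points.
\<close>

subsection \<open>Matrices over finite fields\<close>

lemma carrier_vec_eq_image:
  "(carrier_vec n :: 'a vec set) = (\<lambda>f. vec n f) ` ({..<n} \<rightarrow>\<^sub>E UNIV)"
proof safe
  fix v :: "'a vec" assume v: "v \<in> carrier_vec n"
  have "v = vec n (restrict (($) v) {..<n})"
    using v by (intro eq_vecI) auto
  then show "v \<in> (\<lambda>f. vec n f) ` ({..<n} \<rightarrow>\<^sub>E UNIV)"
    by (intro image_eqI[where x = "restrict (vec_index v) {..<n}"]) auto
qed auto

lemma inj_on_vec_PiE: "inj_on (\<lambda>f. vec n f) ({..<n} \<rightarrow>\<^sub>E UNIV)"
proof (rule inj_onI)
  fix f g :: "nat \<Rightarrow> 'a"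
  assume f: "f \<in> {..<n} \<rightarrow>\<^sub>E UNIV" and g: "g \<in> {..<n} \<rightarrow>\<^sub>E UNIV" and eq: "vec n f = vec n g"
  show "f = g"
  proof (rule PiE_ext[OF f g])
    fix i assume "i \<in> {..<n}"
    then show "f i = g i"
      using arg_cong[OF eq, of "\<lambda>v. vec_index v i"] by simp
  qed
qed

lemma finite_carrier_vec [simp]: "finite (carrier_vec n :: 'a::finite vec set)"
  unfolding carrier_vec_eq_image by (intro finite_imageI finite_PiE) auto

lemma card_carrier_vec: "card (carrier_vec n :: 'a::finite vec set) = CARD('a) ^ n"
  unfolding carrier_vec_eq_image by (simp add: card_image inj_on_vec_PiE card_funcsetE)

lemma card_field_ge_2: "2 \<le> CARD('a::{finite, field})"
proof -
  have "card {0, 1 :: 'a} \<le> CARD('a)"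
    by (rule card_mono) auto
  then show ?thesis
    by simp
qed

lemma invertible_mat_iff_inj:
  fixes A :: "'a::field mat"
  assumes A: "A \<in> carrier_mat n n"
  shows "invertible_mat A \<longleftrightarrow> (\<forall>v\<in>carrier_vec n. A *\<^sub>v v = 0\<^sub>v n \<longrightarrow> v = 0\<^sub>v n)"
proof
  assume "invertible_mat A"
  then obtain B where B: "B * A = 1\<^sub>m (dim_row B)" "A * B = 1\<^sub>m n"
    using A by (auto simp: invertible_mat_def inverts_mat_def)
  have Bc: "B \<in> carrier_mat n n"
    using B A by (metis carrier_matD(2) carrier_matI index_mult_mat(3) index_one_mat(3))
  show "\<forall>v\<in>carrier_vec n. A *\<^sub>v v = 0\<^sub>v n \<longrightarrow> v = 0\<^sub>v n"
  proof safe
    fix v assume v: "v \<in> carrier_vec n" and 0: "A *\<^sub>v v = 0\<^sub>v n"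
    have "v = (B * A) *\<^sub>v v"
      using B Bc v by simp
    also have "\<dots> = B *\<^sub>v (A *\<^sub>v v)"
      using assoc_mult_mat_vec[OF Bc A v] .
    also have "\<dots> = 0\<^sub>v n"
      using Bc 0 by (auto intro!: eq_vecI)
    finally show "v = 0\<^sub>v n" .
  qed
next
  assume inj: "\<forall>v\<in>carrier_vec n. A *\<^sub>v v = 0\<^sub>v n \<longrightarrow> v = 0\<^sub>v n"
  then have "det A \<noteq> 0"
    using det_0_iff_vec_prod_zero_field[OF A] by blast
  from det_non_zero_imp_unit[OF A this, of "()"] show "invertible_mat A"
    using A unfolding Units_def ring_mat_def invertible_mat_def inverts_mat_def by auto
qed

lemma invertible_mat_det:
  fixes A :: "'a::field mat"
  assumes A: "A \<in> carrier_mat n n" and "invertible_mat A"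
  shows "det A \<noteq> 0"
  using assms det_0_iff_vec_prod_zero_field[OF A] invertible_mat_iff_inj[OF A] by blast

text \<open>A maximal independent set of columns omits the zero vector. This puts I/O above
  bandwidth, so that one lower bound serves both.\<close>

lemma mat_rank_le_nonzero_cols:
  fixes A :: "'a::field mat"
  shows "mat_rank A \<le> nonzero_cols A"
proof -
  define m where "m = dim_row A"
  interpret vec_space "TYPE('a)" m .
  have A: "A \<in> carrier_mat m (dim_col A)"
    by (simp add: m_def)
  have li0: "lin_indpt {}"
    unfolding lin_dep_def by simp
  obtain S where S: "maximal S (\<lambda>T. T \<subseteq> set (cols A) \<and> lin_indpt T)"
    using maximal_exists_superset[of "set (cols A)" "\<lambda>T. T \<subseteq> set (cols A) \<and> lin_indpt T" "{}"]
      li0 by auto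
  have Sc: "S \<subseteq> set (cols A)" "lin_indpt S"
    using S by (auto simp: maximal_def)
  have "S \<subseteq> carrier_vec m"
    using Sc(1) A cols_dim by blast
  then have "0\<^sub>v m \<notin> S"
    using Sc(2) vs_zero_lin_dep[of S] by auto
  then have "S \<subseteq> col A ` {j. j < dim_col A \<and> col A j \<noteq> 0\<^sub>v m}"
    using Sc(1) by (fastforce simp: cols_def)
  then have "card S \<le> card (col A ` {j. j < dim_col A \<and> col A j \<noteq> 0\<^sub>v m})"
    by (intro card_mono) auto
  also have "\<dots> \<le> nonzero_cols A"
    unfolding nonzero_cols_def m_def by (intro card_image_le) auto
  finally show ?thesis
    using rank_card_indpt[OF A S] by (simp add: mat_rank_def m_def)
qed

lemma mat_rank_le_dim_col: "mat_rank (A :: 'a::field mat) \<le> dim_col A"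
  using vec_space.rank_le_nc[of A "dim_row A" "dim_col A"] by (simp add: mat_rank_def)

lemma mat_rank_le_dim_row: "mat_rank (A :: 'a::field mat) \<le> dim_row A"
proof -
  define m where "m = dim_row A"
  interpret vec_space "TYPE('a)" m .
  have A: "A \<in> carrier_mat m (dim_col A)"
    by (simp add: m_def)
  have li0: "lin_indpt {}"
    unfolding lin_dep_def by simp
  obtain S where S: "maximal S (\<lambda>T. T \<subseteq> set (cols A) \<and> lin_indpt T)"
    using maximal_exists_superset[of "set (cols A)" "\<lambda>T. T \<subseteq> set (cols A) \<and> lin_indpt T" "{}"]
      li0 by auto
  have "S \<subseteq> set (cols A)" "lin_indpt S"
    using S by (auto simp: maximal_def)
  moreover from this have "S \<subseteq> carrier_vec m"
    using A cols_dim by blast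
  ultimately have "card S \<le> m"
    using li_le_dim(2)[of S] by (simp add: dim_is_n)
  then show ?thesis
    using rank_card_indpt[OF A S] by (simp add: mat_rank_def m_def)
qed

lemma dim_mat_kernel:
  fixes A :: "'a::field mat"
  assumes A: "A \<in> carrier_mat m k"
  shows "mat_rank A + vectorspace.dim class_ring (module_vec TYPE('a) k \<lparr>carrier := mat_kernel A\<rparr>) = k"
    and "VectorSpace.subspace class_ring (mat_kernel A) (module_vec TYPE('a) k)"
proof -
  interpret W: vec_space "TYPE('a)" m .
  interpret V: vec_space "TYPE('a)" k .
  interpret T: linear_map class_ring V.V W.V "\<lambda>v. A *\<^sub>v v"
    using A by unfold_locales
      (auto simp: LinearCombinations.module_hom_def class_ring_simps mult_add_distrib_mat_vec[OF A] mult_mat_vec[OF A])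
  have ker: "T.ker = mat_kernel A"
    using A by (auto simp: T.ker_def mat_kernel_def)
  have im: "T.im = W.col_space A"
    unfolding T.im_def W.col_space_eq[OF A] using A by auto
  have "vectorspace.dim class_ring (W.vs (W.col_space A)) = W.rank A"
    unfolding W.rank_def W.col_space_def ..
  then show "mat_rank A + vectorspace.dim class_ring (module_vec TYPE('a) k \<lparr>carrier := mat_kernel A\<rparr>) = k"
    using T.rank_nullity[OF V.fin_dim] A unfolding ker im by (simp add: mat_rank_def V.dim_is_n)
  show "VectorSpace.subspace class_ring (mat_kernel A) (module_vec TYPE('a) k)"
    using T.kerT_is_subspace unfolding ker .
qed

text \<open>Inclusion-exclusion: without a common point the three pairwise intersections are
  disjoint, and each lowers \<open>3 * t\<close> by at least two.\<close>

lemma card_three_Un_le: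
  assumes fin: "finite A" "finite B" "finite C" and t: "card A = t" "card B = t" "card C = t"
    and meet: "2 \<le> card (A \<inter> B)" "2 \<le> card (B \<inter> C)" "2 \<le> card (C \<inter> A)" and disj: "A \<inter> B \<inter> C = {}"
  shows "card (A \<union> B \<union> C) + 6 \<le> 3 * t"
proof -
  have "card (A \<union> B) + card (A \<inter> B) = 2 * t"
    using card_Un_Int[OF fin(1,2)] t by simp
  moreover have "card (A \<union> B \<union> C) + card ((A \<union> B) \<inter> C) = card (A \<union> B) + t"
    using card_Un_Int[of "A \<union> B" C] fin t by simp
  moreover have "(A \<union> B) \<inter> C = (C \<inter> A) \<union> (B \<inter> C)"
    by blast
  moreover have "card ((C \<inter> A) \<union> (B \<inter> C)) = card (C \<inter> A) + card (B \<inter> C)"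
    using fin disj by (intro card_Un_disjoint) auto
  ultimately show ?thesis
    using meet by simp
qed

lemma card_le_mult_fibres:
  assumes "finite A" "finite (f ` A)" "\<And>y. y \<in> f ` A \<Longrightarrow> card {x \<in> A. f x = y} \<le> k"
  shows "card A \<le> k * card (f ` A)"
proof -
  have "A = (\<Union>y\<in>f ` A. {x \<in> A. f x = y})"
    by auto
  then have "card A = card (\<Union>y\<in>f ` A. {x \<in> A. f x = y})"
    by (rule arg_cong)
  also have "\<dots> \<le> (\<Sum>y\<in>f ` A. card {x \<in> A. f x = y})"
    using assms(2) by (rule card_UN_le)
  also have "\<dots> \<le> (\<Sum>y\<in>f ` A. k)"
    by (intro sum_mono assms(3))
  finally show ?thesis
    by (simp add: mult.commute)
qed

text \<open>Counting form of rank-nullity: the image is spanned by \<open>mat_rank A\<close>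
  columns, which bounds its size, and every fibre is a translate of the kernel.\<close>

lemma card_mat_kernel_ge:
  fixes A :: "'a::{finite, field} mat"
  assumes A: "A \<in> carrier_mat m k"
  shows "CARD('a) ^ (k - mat_rank A) \<le> card (mat_kernel A)"
proof -
  interpret vec_space "TYPE('a)" m .
  have li0: "lin_indpt {}"
    unfolding lin_dep_def by simp
  obtain S where S: "maximal S (\<lambda>T. T \<subseteq> set (cols A) \<and> lin_indpt T)"
    using maximal_exists_superset[of "set (cols A)" "\<lambda>T. T \<subseteq> set (cols A) \<and> lin_indpt T" "{}"]
      li0 by auto
  have Sc: "S \<subseteq> set (cols A)" "lin_indpt S"
    using S by (auto simp: maximal_def)
  have colsA: "set (cols A) \<subseteq> carrier_vec m"
    using A cols_dim by blast
  have S': "S \<subseteq> carrier_vec m" "finite S"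
    using Sc(1) colsA finite_subset by blast+
  have cS: "card S = mat_rank A"
    using rank_card_indpt[OF A S] A by (simp add: mat_rank_def)
  have "v \<in> span S" if v: "v \<in> set (cols A)" for v
  proof (rule ccontr)
    assume nv: "v \<notin> span S"
    have "lin_indpt (insert v S)"
      using lin_dep_iff_in_span[OF S'(1) Sc(2), of v] nv v colsA in_own_span[OF S'(1)]
      by (metis (no_types, lifting) Un_insert_right subsetD sup_bot_right)
    then have "insert v S = S"
      using S v Sc(1) unfolding maximal_def by (metis insert_subset subset_insertI)
    then show False
      using nv in_own_span[OF S'(1)] by auto
  qed
  then have "col_space A \<subseteq> span S"
    unfolding col_space_def by (intro span_subsetI) (use S' in auto)
  then have "(*\<^sub>v) A ` carrier_vec k \<subseteq> span S"
    unfolding col_space_eq[OF A] using A by auto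
  also have "\<dots> \<subseteq> (\<lambda>a. lincomb a S) ` (S \<rightarrow>\<^sub>E UNIV)"
  proof
    fix v assume "v \<in> span S"
    then have "\<exists>a. v = lincomb a S"
      unfolding finite_span[OF S'(2,1)] by auto
    then obtain a where a: "v = lincomb a S"
      by (rule exE)
    \<comment> \<open>Coefficients outside \<open>S\<close> are reset to a default value, which
      leaves finitely many functions to count.\<close>
    have "lincomb a S = lincomb (restrict a S) S"
      using S' by (intro lincomb_cong) auto
    then show "v \<in> (\<lambda>a. lincomb a S) ` (S \<rightarrow>\<^sub>E UNIV)"
      unfolding a by (intro image_eqI[where x = "restrict a S"]) auto
  qed
  finally have sub: "(*\<^sub>v) A ` carrier_vec k \<subseteq> (\<lambda>a. lincomb a S) ` (S \<rightarrow>\<^sub>E UNIV)" .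
  have fin: "finite (S \<rightarrow>\<^sub>E (UNIV :: 'a set))"
    using S' by (intro finite_PiE) auto
  have c1: "card ((*\<^sub>v) A ` carrier_vec k) \<le> CARD('a) ^ mat_rank A"
  proof -
    have "card ((*\<^sub>v) A ` carrier_vec k) \<le> card ((\<lambda>a. lincomb a S) ` (S \<rightarrow>\<^sub>E (UNIV :: 'a set)))"
      using sub fin by (intro card_mono) auto
    also have "\<dots> \<le> card (S \<rightarrow>\<^sub>E (UNIV :: 'a set))"
      by (rule card_image_le[OF fin])
    finally show ?thesis
      using S' cS by (simp add: card_funcsetE)
  qed
  have "card (carrier_vec k :: 'a vec set) \<le> card (mat_kernel A) * card ((*\<^sub>v) A ` carrier_vec k)"
  proof (rule card_le_mult_fibres)
    fix y assume "y \<in> (*\<^sub>v) A ` carrier_vec k"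
    then obtain x0 where x0: "x0 \<in> carrier_vec k" "y = A *\<^sub>v x0"
      by auto
    have "x - x0 \<in> mat_kernel A" if "x \<in> carrier_vec k" "A *\<^sub>v x = y" for x
      using that x0 A by (intro mat_kernelI[OF A]) (auto simp: mult_minus_distrib_mat_vec[OF A])
    moreover have "inj_on (\<lambda>x. x - x0) (carrier_vec k)"
    proof (rule inj_onI)
      fix x y assume *: "x \<in> carrier_vec k" "y \<in> carrier_vec k" "x - x0 = y - x0"
      show "x = y"
      proof (rule eq_vecI)
        fix i assume "i < dim_vec y"
        moreover have "(x - x0) $ i = (y - x0) $ i"
          using *(3) by simp
        ultimately show "x $ i = y $ i"
          using *(1,2) x0 by simp
      qed (use * in auto)
    qed
    ultimately show "card {x \<in> carrier_vec k. A *\<^sub>v x = y} \<le> card (mat_kernel A)"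
      by (intro card_inj_on_le[of "\<lambda>x. x - x0"])
        (auto intro: inj_on_subset finite_subset[OF mat_kernel_carrier[OF A]])
  qed auto
  also have "\<dots> \<le> card (mat_kernel A) * CARD('a) ^ mat_rank A"
    using c1 by (intro mult_left_mono) auto
  finally have "CARD('a) ^ k \<le> card (mat_kernel A) * CARD('a) ^ mat_rank A"
    by (simp add: card_carrier_vec)
  moreover have "CARD('a) ^ k = CARD('a) ^ (k - mat_rank A) * CARD('a) ^ mat_rank A"
    using mat_rank_le_dim_col[of A] A by (simp flip: power_add)
  ultimately show ?thesis
    by (metis finite_UNIV_card_ge_0 finite mult_le_cancel2 zero_less_power)
qed

subsection \<open>Parity-check matrices with two block rows\<close>

text \<open>The partial spread condition: the blocks of two nodes are injective and their column
  spaces meet only in \<open>0\<close>. For \<open>r = 2\<close> it implies MDS without mention of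
  \<open>submatrix\<close>.\<close>

definition blocks_independent :: "nat \<Rightarrow> nat \<Rightarrow> 'a::field mat \<Rightarrow> bool" where
  "blocks_independent n l H \<longleftrightarrow> (\<forall>i<n. \<forall>j<n. i \<noteq> j \<longrightarrow>
     (\<forall>v\<in>carrier_vec l. \<forall>w\<in>carrier_vec l.
        block l H i *\<^sub>v v + block l H j *\<^sub>v w = 0\<^sub>v (dim_row H) \<longrightarrow> v = 0\<^sub>v l \<and> w = 0\<^sub>v l))"

lemma block_carrier: "H \<in> carrier_mat m N \<Longrightarrow> block l H i \<in> carrier_mat m l"
  by (simp add: block_def)

lemma mult_mat_vec_zero: "A \<in> carrier_mat m k \<Longrightarrow> A *\<^sub>v 0\<^sub>v k = (0\<^sub>v m :: 'a::semiring_0 vec)"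
  by (intro eq_vecI) (auto intro!: scalar_prod_right_zero carrier_vecI)

lemma blocks_independentD:
  assumes "blocks_independent n l H" "H \<in> carrier_mat m N" "i < n" "j < n" "i \<noteq> j"
    and "v \<in> carrier_vec l" "w \<in> carrier_vec l" "block l H i *\<^sub>v v = block l H j *\<^sub>v w"
  shows "v = 0\<^sub>v l"
proof -
  have B: "block l H j \<in> carrier_mat m l"
    by (rule block_carrier[OF assms(2)])
  have "block l H i *\<^sub>v v + block l H j *\<^sub>v (- w) = 0\<^sub>v m"
    unfolding assms(8) using B assms(7)
    by (intro eq_vecI) (auto simp flip: uminus_scalar_prod)
  then show ?thesis
    using assms unfolding blocks_independent_def
    by (metis carrier_matD(1) uminus_carrier_vec)
qed

lemma block_index_less:
  assumes "i < n" "b < (l::nat)"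
  shows "i * l + b < n * l"
proof -
  have "i * l + b < Suc i * l"
    using assms(2) by simp
  also have "\<dots> \<le> n * l"
    using assms(1) by (intro mult_le_mono1) simp
  finally show ?thesis .
qed

lemma sum_div_in_block:
  fixes f :: "nat \<Rightarrow> 'b::comm_monoid_add"
  assumes "I \<subseteq> {..<n}" 
  shows "(\<Sum>c | c < n * l \<and> c div l \<in> I. f c) = (\<Sum>i\<in>I. \<Sum>b<l. f (i * l + b))"
proof (cases "l = 0")
  case False
  then have lpos: "0 < l"
    by simp
  have "(\<Sum>i\<in>I. \<Sum>b<l. f (i * l + b)) = (\<Sum>(i, b)\<in>I \<times> {..<l}. f (i * l + b))"
    by (simp add: sum.cartesian_product)
  also have "\<dots> = (\<Sum>c | c < n * l \<and> c div l \<in> I. f c)"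
    using assms
    by (intro sum.reindex_bij_witness[of _ "\<lambda>c. (c div l, c mod l)" "\<lambda>(i, b). i * l + b"])
      (use lpos in \<open>auto intro!: block_index_less\<close>)
  finally show ?thesis ..
qed simp

text \<open>A vector killed by the square matrix, cut along the two blocks, is a relation between
  their column spaces. The work lies in the numbering: \<open>submatrix\<close> lists the selected
  columns in increasing order through \<open>pick\<close>.\<close>

lemma mds_matrixI:
  fixes H :: "'a::field mat"
  assumes H: "H \<in> carrier_mat (2 * l) (n * l)" and ind: "blocks_independent n l H"
  shows "mds_matrix n 2 l H"
  unfolding mds_matrix_def
proof (intro allI impI)
  fix I assume "I \<subseteq> {..<n} \<and> card I = 2"
  then have I: "I \<subseteq> {..<n}" "card I = 2"
    by auto
  then obtain i j where ij: "I = {i, j}" "i \<noteq> j" "i < n" "j < n"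
    by (auto simp: card_2_iff)
  \<comment> \<open>\<open>J\<close> selects columns, \<open>J'\<close> is its part inside the
    matrix, and \<open>pos c\<close> counts the selected columns before \<open>c\<close>, which
    makes \<open>pos\<close> inverse to \<open>pick J\<close> on \<open>J'\<close>.\<close>
  define J where "J = {c. c div l \<in> I}"
  define J' where "J' = {c. c < n * l \<and> c div l \<in> I}"
  define pos where "pos c = card {a \<in> J. a < c}" for c
  define A where "A = block_cols l H I"
  have cardJ': "card J' = 2 * l"
    using sum_div_in_block[OF I(1), where l = l and f = "\<lambda>_. 1::nat"] ij by (simp add: J'_def)
  have A: "A \<in> carrier_mat (2 * l) (2 * l)"
    using H cardJ' by (intro carrier_matI) (auto simp: A_def block_cols_def dim_submatrix J'_def)
  have pick_pos: "pick J (pos c) = c" if "c \<in> J'" for c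
    unfolding pos_def by (rule pick_card_in_set) (use that in \<open>auto simp: J_def J'_def\<close>)
  have inj: "inj_on pos J'"
    by (rule inj_on_inverseI[of _ "pick J"]) (rule pick_pos)
  have pos_less: "pos c < 2 * l" if "c \<in> J'" for c
  proof -
    have "{a \<in> J. a < c} \<subset> J'"
      using that by (auto simp: J_def J'_def)
    then show ?thesis
      unfolding pos_def cardJ'[symmetric] by (intro psubset_card_mono) (auto simp: J'_def)
  qed
  have img: "pos ` J' = {..<2 * l}"
  proof (rule card_subset_eq)
    show "card (pos ` J') = card {..<2 * l}"
      using card_image[OF inj] cardJ' by simp
  qed (use pos_less in auto)
  have A_pos: "A $$ (r, pos c) = H $$ (r, c)" if "r < 2 * l" "c \<in> J'" for r c
    using submatrix_index[of r H UNIV "pos c" J] pos_less[OF that(2)] that H cardJ' pick_pos[OF that(2)]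
    by (simp add: A_def block_cols_def J_def J'_def pick_UNIV)
  show "invertible_mat (block_cols l H I)"
    unfolding A_def[symmetric] invertible_mat_iff_inj[OF A]
  proof safe
    fix x assume x: "x \<in> carrier_vec (2 * l)" and 0: "A *\<^sub>v x = 0\<^sub>v (2 * l)"
    define v where "v k = vec l (\<lambda>b. x $ pos (k * l + b))" for k
    have "block l H i *\<^sub>v v i + block l H j *\<^sub>v v j = A *\<^sub>v x"
    proof (rule eq_vecI)
      fix r assume "r < dim_vec (A *\<^sub>v x)"
      then have r: "r < 2 * l"
        using A by simp
      have "(A *\<^sub>v x) $ r = (\<Sum>b<2 * l. A $$ (r, b) * x $ b)"
        using A x r by (simp add: scalar_prod_def atLeast0LessThan)
      also have "\<dots> = (\<Sum>c\<in>J'. H $$ (r, c) * x $ pos c)"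
        unfolding img[symmetric] sum.reindex[OF inj] by (intro sum.cong) (auto simp: A_pos r)
      also have "\<dots> = (\<Sum>k\<in>I. \<Sum>b<l. H $$ (r, k * l + b) * x $ pos (k * l + b))"
        unfolding J'_def by (rule sum_div_in_block[OF I(1)])
      also have "\<dots> = (\<Sum>k\<in>I. (block l H k *\<^sub>v v k) $ r)"
        using H r by (intro sum.cong) (auto simp: scalar_prod_def v_def block_def atLeast0LessThan)
      finally show "(block l H i *\<^sub>v v i + block l H j *\<^sub>v v j) $ r = (A *\<^sub>v x) $ r"
        using ij H r by (simp add: block_def)
    qed (use A H in \<open>auto simp: block_def\<close>)
    then have "block l H i *\<^sub>v v i + block l H j *\<^sub>v v j = 0\<^sub>v (dim_row H)"
      using 0 H by simp
    moreover have "v i \<in> carrier_vec l" "v j \<in> carrier_vec l"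
      by (simp_all add: v_def)
    ultimately have "v i = 0\<^sub>v l \<and> v j = 0\<^sub>v l"
      using ind ij(2-4) unfolding blocks_independent_def by blast
    then have v0: "v k = 0\<^sub>v l" if "k \<in> I" for k
      using that ij by auto
    have "x $ pos c = 0" if "c \<in> J'" for c
    proof -
      have "0 < l"
        using that by (cases l) (auto simp: J'_def)
      then have "v (c div l) $ (c mod l) = x $ pos c"
        by (simp add: v_def)
      then show ?thesis
        using v0[of "c div l"] that \<open>0 < l\<close> by (simp add: J'_def)
    qed
    moreover have "b \<in> pos ` J'" if "b < 2 * l" for b
      using that by (simp add: img)
    ultimately have "x $ b = 0" if "b < 2 * l" for b
      using that by blast
    then show "x = 0\<^sub>v (2 * l)"
      using x by (intro eq_vecI) auto
  qed
qed

text \<open>The first \<open>r\<close> blocks form a nonsingular minor with all \<open>r * l\<close>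
  rows, and a minor bounds the rank from below.\<close>

lemma mat_rank_mds:
  fixes H :: "'a::field mat"
  assumes H: "H \<in> carrier_mat (r * l) (n * l)" and mds: "mds_matrix n r l H" and "r \<le> n"
  shows "mat_rank H = r * l"
proof (rule antisym)
  show "mat_rank H \<le> r * l"
    using mat_rank_le_dim_row[of H] H by simp
  have I: "{..<r} \<subseteq> {..<n}"
    using assms(3) by auto
  then have inv: "invertible_mat (block_cols l H {..<r})"
    using mds unfolding mds_matrix_def by simp
  have card: "card {c. c < n * l \<and> c div l \<in> {..<r}} = r * l"
    using sum_div_in_block[OF I, where l = l and f = "\<lambda>_. 1::nat"] by simp
  have "block_cols l H {..<r} \<in> carrier_mat (r * l) (r * l)"
    using H card by (intro carrier_matI) (auto simp: block_cols_def dim_submatrix)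
  then have "det (block_cols l H {..<r}) \<noteq> 0"
    using inv by (rule invertible_mat_det)
  then show "r * l \<le> mat_rank H"
    using vec_space.rank_gt_minor[OF H, of UNIV "{c. c div l \<in> {..<r}}"] card H
    by (simp add: block_cols_def mat_rank_def)
qed

section \<open>Upper bound on the saving of a repair matrix\<close>

text \<open>Since \<open>M * block l H i\<close> is injective, \<open>M\<close> recovers
  \<open>x\<close> from \<open>u + H\<^sub>i x\<close> with \<open>u\<close> in its kernel. These
  sums are therefore pairwise distinct, and they fit into a space of dimension
  \<open>2 * l\<close>.\<close>

lemma card_mat_kernel_repair_mat:
  fixes H :: "'a::{finite, field} mat"
  assumes H: "H \<in> carrier_mat (2 * l) (n * l)" and M: "M \<in> repair_mats 2 l H i"
  shows "card (mat_kernel M) \<le> CARD('a) ^ l"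
proof -
  have Mc: "M \<in> carrier_mat l (2 * l)" and inv: "invertible_mat (M * block l H i)"
    using M by (auto simp: repair_mats_def)
  have B: "block l H i \<in> carrier_mat (2 * l) l"
    by (rule block_carrier[OF H])
  have MB: "M * block l H i \<in> carrier_mat l l"
    using Mc B by simp
  define f where "f = (\<lambda>(u, x). u + block l H i *\<^sub>v x)"
  have Mf: "M *\<^sub>v f (u, x) = (M * block l H i) *\<^sub>v x"
    if "u \<in> mat_kernel M" "x \<in> carrier_vec l" for u x
    using that mat_kernelD[OF Mc that(1)] B MB Mc
    by (simp add: f_def mult_add_distrib_mat_vec[OF Mc] assoc_mult_mat_vec[OF Mc B])
  have "inj_on f (mat_kernel M \<times> carrier_vec l)"
  proof (rule inj_onI, clarify)
    fix u x u' x'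
    assume u: "u \<in> mat_kernel M" "u' \<in> mat_kernel M" and x: "x \<in> carrier_vec l" "x' \<in> carrier_vec l"
      and eq: "f (u, x) = f (u', x')"
    have "(M * block l H i) *\<^sub>v x = (M * block l H i) *\<^sub>v x'"
      using Mf u x eq by metis
    then have "(M * block l H i) *\<^sub>v (x - x') = 0\<^sub>v l"
      using mult_minus_distrib_mat_vec[OF MB x] MB x by simp
    then have d: "x - x' = 0\<^sub>v l"
      using inv invertible_mat_iff_inj[OF MB] x by simp
    have xx: "x = x'"
    proof (rule eq_vecI)
      fix a assume "a < dim_vec x'"
      moreover have "(x - x') $ a = (0\<^sub>v l) $ a"
        using d by simp
      ultimately show "x $ a = x' $ a"
        using x by simp
    qed (use x in auto)
    have uc: "u \<in> carrier_vec (2 * l)" "u' \<in> carrier_vec (2 * l)"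
      using mat_kernelD(1)[OF Mc] u by auto
    have "u = u'"
    proof (rule eq_vecI)
      fix a assume a: "a < dim_vec u'"
      have "f (u, x) $ a = f (u', x) $ a"
        using eq xx by simp
      then show "u $ a = u' $ a"
        using a uc B by (simp add: f_def)
    qed (use uc in auto)
    with xx show "u = u' \<and> x = x'"
      by simp
  qed
  moreover have "f ` (mat_kernel M \<times> carrier_vec l) \<subseteq> carrier_vec (2 * l)"
    using B mat_kernel_carrier[OF Mc] by (auto simp: f_def)
  ultimately have "card (mat_kernel M \<times> (carrier_vec l :: 'a vec set)) \<le> card (carrier_vec (2 * l) :: 'a vec set)"
    by (rule card_inj_on_le) simp
  then have "card (mat_kernel M) * CARD('a) ^ l \<le> CARD('a) ^ l * CARD('a) ^ l"
    by (simp add: card_cartesian_product card_carrier_vec mult_2 power_add)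
  then show ?thesis
    by simp
qed

text \<open>The kernels of the matrices \<open>M H\<^sub>j\<close> embed as subspaces of the kernel of \<open>M\<close> that meet only in \<open>0\<close>.\<close>
lemma repair_rank_deficit:
  fixes H :: "'a::{finite, field} mat"
  assumes H: "H \<in> carrier_mat (2 * l) (n * l)" and ind: "blocks_independent n l H"
    and i: "i < n" and M: "M \<in> repair_mats 2 l H i"
  shows "(CARD('a) - 1) * (\<Sum>j\<in>{..<n} - {i}. l - mat_rank (M * block l H j)) \<le> CARD('a) ^ l - 1"
proof -
  let ?q = "CARD('a)"
  have q: "2 \<le> ?q"
    by (rule card_field_ge_2)
  have Mc: "M \<in> carrier_mat l (2 * l)"
    using M by (auto simp: repair_mats_def)
  have B: "block l H j \<in> carrier_mat (2 * l) l" for j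
    by (rule block_carrier[OF H])
  have MB: "M * block l H j \<in> carrier_mat l l" for j
    using Mc B by simp
  \<comment> \<open>For a helper \<open>j\<close>, the set \<open>W j\<close> consists of the
    nonzero vectors that the kernel of \<open>M\<close> shares with the column space of block
    \<open>j\<close>; \<open>N j\<close> parametrizes it.\<close>
  define N where "N j = mat_kernel (M * block l H j) - {0\<^sub>v l}" for j
  define W where "W j = (*\<^sub>v) (block l H j) ` N j" for j
  have Nc: "N j \<subseteq> carrier_vec l" for j
    using mat_kernel_carrier[OF MB] by (auto simp: N_def)
  have finN: "finite (N j)" for j
    using finite_subset[OF Nc] by simp
  have eq0: "v = 0\<^sub>v l" if "block l H j *\<^sub>v v = block l H k *\<^sub>v w" "j < n" "k < n" "j \<noteq> k"
    "v \<in> carrier_vec l" "w \<in> carrier_vec l" for j k v w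
    using blocks_independentD[OF ind H] that by blast
  have cardW: "card (W j) = card (N j)" if "j \<in> {..<n} - {i}" for j
    unfolding W_def
  proof (intro card_image inj_onI)
    fix x y assume xy: "x \<in> N j" "y \<in> N j" "block l H j *\<^sub>v x = block l H j *\<^sub>v y"
    then have c: "x \<in> carrier_vec l" "y \<in> carrier_vec l"
      using Nc by auto
    \<comment> \<open>Independence compares two different blocks; block \<open>i\<close> with the
      vector \<open>0\<close> is the partner that yields injectivity of block
      \<open>j\<close>.\<close>
    have "block l H j *\<^sub>v (x - y) = block l H i *\<^sub>v 0\<^sub>v l"
      using mult_minus_distrib_mat_vec[OF B[of j] c] xy(3) c carrier_matD[OF B[of j]]
      unfolding mult_mat_vec_zero[OF B] by (auto intro!: eq_vecI)
    then have d: "x - y = 0\<^sub>v l"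
      using eq0[of j "x - y" i "0\<^sub>v l"] that i c by auto
    show "x = y"
    proof (rule eq_vecI)
      fix a assume "a < dim_vec y"
      moreover have "(x - y) $ a = (0\<^sub>v l) $ a"
        using d by simp
      ultimately show "x $ a = y $ a"
        using c by simp
    qed (use c in auto)
  qed
  have disj: "W j \<inter> W k = {}" if "j \<in> {..<n} - {i}" "k \<in> {..<n} - {i}" "j \<noteq> k" for j k
  proof (rule ccontr)
    assume "W j \<inter> W k \<noteq> {}"
    then obtain v w where vw: "v \<in> N j" "w \<in> N k" "block l H j *\<^sub>v v = block l H k *\<^sub>v w"
      by (auto simp: W_def)
    then have "v = 0\<^sub>v l"
      using eq0[OF vw(3)] that Nc by blast
    then show False
      using vw(1) by (simp add: N_def)
  qed
  have sub: "W j \<subseteq> mat_kernel M - {0\<^sub>v (2 * l)}" if j: "j \<in> {..<n} - {i}" for j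
  proof
    fix u assume "u \<in> W j"
    then obtain x where x: "x \<in> N j" "u = block l H j *\<^sub>v x"
      by (auto simp: W_def)
    have xc: "x \<in> carrier_vec l" and xk: "x \<in> mat_kernel (M * block l H j)" and x0: "x \<noteq> 0\<^sub>v l"
      using x(1) Nc by (auto simp: N_def)
    have "M *\<^sub>v u = 0\<^sub>v l"
      using mat_kernelD(2)[OF MB xk] assoc_mult_mat_vec[OF Mc B xc] x by simp
    then have "u \<in> mat_kernel M"
      using x B[of j] xc by (intro mat_kernelI[OF Mc]) auto
    moreover have "u \<noteq> 0\<^sub>v (2 * l)"
    proof
      assume "u = 0\<^sub>v (2 * l)"
      then have "block l H j *\<^sub>v x = block l H i *\<^sub>v 0\<^sub>v l"
        using x unfolding mult_mat_vec_zero[OF B] by simp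
      then show False
        using eq0[of j x i "0\<^sub>v l"] j i xc x0 by auto
    qed
    ultimately show "u \<in> mat_kernel M - {0\<^sub>v (2 * l)}"
      by simp
  qed
  have finK: "finite (mat_kernel M)"
    using finite_subset[OF mat_kernel_carrier[OF Mc]] by simp
  have step: "(?q - 1) * (l - mat_rank (M * block l H j)) \<le> card (N j)" for j
  proof -
    define d where "d = l - mat_rank (M * block l H j)"
    have z: "0\<^sub>v l \<in> mat_kernel (M * block l H j)"
      using mult_mat_vec_zero[OF MB] by (intro mat_kernelI[OF MB]) auto
    \<comment> \<open>A kernel of dimension \<open>d\<close> has \<open>q ^ d - 1\<close> nonzero
      vectors, at least \<open>(q - 1) * d\<close> by Bernoulli's inequality, with equality for
      \<open>d = 1\<close>.\<close>
    have "real (?q - 1) * real d + 1 \<le> (1 + real (?q - 1)) ^ d"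
      using Bernoulli_inequality[of "real (?q - 1)" d] by (simp add: algebra_simps)
    also have "1 + real (?q - 1) = real ?q"
      using q by simp
    finally have "real ((?q - 1) * d + 1) \<le> real (?q ^ d)"
      by simp
    then have "(?q - 1) * d + 1 \<le> ?q ^ d"
      by (simp only: of_nat_le_iff)
    also have "\<dots> \<le> card (mat_kernel (M * block l H j))"
      using card_mat_kernel_ge[OF MB] by (simp add: d_def)
    finally show ?thesis
      using z by (simp add: N_def d_def card_Diff_singleton)
  qed
  have "(?q - 1) * (\<Sum>j\<in>{..<n} - {i}. l - mat_rank (M * block l H j)) \<le> (\<Sum>j\<in>{..<n} - {i}. card (N j))"
    unfolding sum_distrib_left by (intro sum_mono step)
  also have "\<dots> = (\<Sum>j\<in>{..<n} - {i}. card (W j))"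
    by (intro sum.cong) (auto simp: cardW)
  also have "\<dots> = card (\<Union>j\<in>{..<n} - {i}. W j)"
    using disj finN by (intro card_UN_disjoint[symmetric]) (auto simp: W_def)
  also have "\<dots> \<le> card (mat_kernel M - {0\<^sub>v (2 * l)})"
    using sub finK by (intro card_mono) auto
  also have "\<dots> = card (mat_kernel M) - 1"
    using finK mult_mat_vec_zero[OF Mc] by (intro card_Diff_singleton mat_kernelI[OF Mc]) auto
  also have "\<dots> \<le> ?q ^ l - 1"
    using card_mat_kernel_repair_mat[OF H M] by simp
  finally show ?thesis .
qed

lemma repair_bw_le_io: "repair_bw n l H i M \<le> repair_io n l H i M"
  unfolding repair_bw_def repair_io_def by (intro sum_mono mat_rank_le_nonzero_cols)

lemma repair_bw_ge:
  fixes H :: "'a::{finite, field} mat"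
  assumes H: "H \<in> carrier_mat (2 * l) (n * l)" and ind: "blocks_independent n l H"
    and i: "i < n" and M: "M \<in> repair_mats 2 l H i" and t: "(CARD('a) - 1) * t = CARD('a) ^ l - 1"
  shows "l * (n - 1) \<le> repair_bw n l H i M + t"
proof -
  have q: "2 \<le> CARD('a)"
    by (rule card_field_ge_2)
  have "(CARD('a) - 1) * (\<Sum>j\<in>{..<n} - {i}. l - mat_rank (M * block l H j)) \<le> (CARD('a) - 1) * t"
    using repair_rank_deficit[OF H ind i M] t by simp
  then have "(\<Sum>j\<in>{..<n} - {i}. l - mat_rank (M * block l H j)) \<le> t"
    using q by simp
  moreover have "(\<Sum>j\<in>{..<n} - {i}. l - mat_rank (M * block l H j)) + repair_bw n l H i M
      = (\<Sum>j\<in>{..<n} - {i}. l)"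
    unfolding repair_bw_def sum.distrib[symmetric]
  proof (intro sum.cong refl)
    fix j
    show "l - mat_rank (M * block l H j) + mat_rank (M * block l H j) = l"
      using mat_rank_le_dim_col[of "M * block l H j"] block_carrier[OF H, of l j] by simp
  qed
  ultimately show ?thesis
    using i by (simp add: mult.commute)
qed

lemma repair_mats_nonzero_cols_le:
  assumes H: "H \<in> carrier_mat m (n * l)"
  shows "nonzero_cols (M * block l H j) \<le> l"
proof -
  have "nonzero_cols (M * block l H j) \<le> card {..<l}"
    unfolding nonzero_cols_def using block_carrier[OF H, of l j] by (intro card_mono) auto
  then show ?thesis
    by simp
qed

text \<open>Squeeze: the lower bound holds for bandwidth, bandwidth is at most I/O, and the I/O of
  \<open>M\<close> attains the bound. So the same \<open>M\<close> is optimal for both.\<close>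

lemma min_repair_eqI:
  fixes H :: "'a::{finite, field} mat"
  assumes H: "H \<in> carrier_mat (2 * l) (n * l)" and ind: "blocks_independent n l H"
    and i: "i < n" and t: "(CARD('a) - 1) * t = CARD('a) ^ l - 1"
    and M: "M \<in> repair_mats 2 l H i" and io: "repair_io n l H i M + t \<le> l * (n - 1)"
  shows "min_repair_bw n 2 l H i = l * (n - 1) - t" "min_repair_io n 2 l H i = l * (n - 1) - t"
proof -
  \<comment> \<open>The crude bound \<open>n * l\<close> makes both sets of values finite, as
    \<open>Min\<close> requires.\<close>
  have io_le: "repair_io n l H i M' \<le> n * l" for M'
  proof -
    have "repair_io n l H i M' \<le> (\<Sum>j\<in>{..<n} - {i}. l)"
      unfolding repair_io_def by (intro sum_mono repair_mats_nonzero_cols_le[OF H])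
    then show ?thesis
      using i by (simp add: diff_mult_distrib)
  qed
  have bw_le: "repair_bw n l H i M' \<le> n * l" for M'
    using repair_bw_le_io io_le by (rule order_trans)
  have fin: "finite (repair_io n l H i ` repair_mats 2 l H i)" "finite (repair_bw n l H i ` repair_mats 2 l H i)"
    using io_le bw_le by (auto intro!: finite_subset[of _ "{..n * l}"])
  have ge: "l * (n - 1) - t \<le> repair_bw n l H i M'" if "M' \<in> repair_mats 2 l H i" for M'
    using repair_bw_ge[OF H ind i that t] by simp
  have le: "repair_io n l H i M \<le> l * (n - 1) - t"
    using io by simp
  have eq: "repair_bw n l H i M = l * (n - 1) - t" "repair_io n l H i M = l * (n - 1) - t"
    using ge[OF M] le repair_bw_le_io[of n l H i M] by auto
  show "min_repair_bw n 2 l H i = l * (n - 1) - t"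
    unfolding min_repair_bw_def
    by (rule Min_eqI[OF fin(2)]) (use ge eq M in force)+
  show "min_repair_io n 2 l H i = l * (n - 1) - t"
    unfolding min_repair_io_def
  proof (rule Min_eqI[OF fin(1)])
    fix y assume "y \<in> repair_io n l H i ` repair_mats 2 l H i"
    then show "l * (n - 1) - t \<le> y"
      using ge repair_bw_le_io order_trans by blast
  next
    show "l * (n - 1) - t \<in> repair_io n l H i ` repair_mats 2 l H i"
      using eq(2) M by (metis imageI)
  qed
qed

section \<open>Passage from the matrix to the code\<close>

text \<open>The conclusion of the theorem with a natural number in place of the real quotient
  \<open>t_num l q\<close>.\<close>

definition mds_code_saving :: "nat \<Rightarrow> nat \<Rightarrow> nat \<Rightarrow> 'a::field vec set \<Rightarrow> bool" where
  "mds_code_saving n l t C \<longleftrightarrow>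
      linear_array_code n (n - 2) l C \<and> mds n (n - 2) l C \<and>
      beta_avg n (n - 2) l C = real l * (real n - 1) - real t \<and>
      real (beta_max n (n - 2) l C) = real l * (real n - 1) - real t \<and>
      gamma_avg n (n - 2) l C = real l * (real n - 1) - real t \<and>
      real (gamma_max n (n - 2) l C) = real l * (real n - 1) - real t"

lemma code_of_parity_check:
  fixes H :: "'a::{finite, field} mat"
  assumes H: "H \<in> carrier_mat (2 * l) (n * l)" and ind: "blocks_independent n l H"
    and n: "3 \<le> n" and t: "(CARD('a) - 1) * t = CARD('a) ^ l - 1" and tn: "t \<le> l * (n - 1)"
    and rep: "\<And>i. i < n \<Longrightarrow> \<exists>M\<in>repair_mats 2 l H i. repair_io n l H i M + t \<le> l * (n - 1)"
  defines "C \<equiv> mat_kernel H"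
  shows "mds_code_saving n l t C"
proof -
  have nn: "n - (n - 2) = 2"
    using n by simp
  have mds: "mds_matrix n 2 l H"
    by (rule mds_matrixI[OF H ind])
  have rk: "mat_rank H = 2 * l"
    using mat_rank_mds[OF H mds] n by simp
  have pc: "parity_check n (n - 2) l C H"
    unfolding parity_check_def nn C_def using H rk by simp
  note ind' = parity_check_independent[OF pc, unfolded nn]
  have 1: "linear_array_code n (n - 2) l C"
    unfolding linear_array_code_def C_def using dim_mat_kernel[OF H] rk n
    by (auto simp: diff_mult_distrib)
  have 2: "mds n (n - 2) l C"
    using ind'(1) mds by simp
  have b: "beta n (n - 2) l C i = l * (n - 1) - t" and g: "gamma n (n - 2) l C i = l * (n - 1) - t"
    if "i < n" for i
    using ind'(2,3)[OF that] rep[OF that] min_repair_eqI[OF H ind that t] by auto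
  \<comment> \<open>\<open>tn\<close> makes the truncated difference of naturals agree with the real
    one.\<close>
  have r: "real (l * (n - 1) - t) = real l * (real n - 1) - real t"
    using tn n by simp
  have img: "beta n (n - 2) l C ` {..<n} = {l * (n - 1) - t}" "gamma n (n - 2) l C ` {..<n} = {l * (n - 1) - t}"
    using b g n by (auto intro!: image_eqI[where x = 0])
  have avg: "beta_avg n (n - 2) l C = real (l * (n - 1) - t)" "gamma_avg n (n - 2) l C = real (l * (n - 1) - t)"
    unfolding beta_avg_def gamma_avg_def using b g n by simp_all
  show ?thesis
    using 1 2 avg r unfolding mds_code_saving_def beta_max_def gamma_max_def img by simp
qed

subsection \<open>Extensions of finite fields inside the algebraic closure\<close>

text \<open>\<open>X ^ m - c\<close> is separable: its derivative vanishes at most at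
  \<open>0\<close>, which is not a root because \<open>c \<noteq> 0\<close>. Over an algebraically
  closed field it therefore has \<open>m\<close> distinct roots.\<close>

lemma card_nth_roots:
  fixes c :: "'k::alg_closed_field"
  assumes m: "of_nat m \<noteq> (0 :: 'k)" and c: "c \<noteq> 0"
  shows "card {y. y ^ m = c} = m" "finite {y. y ^ m = c}"
proof -
  have m0: "0 < m"
    using m by (cases m) auto
  define p where "p = Polynomial.monom 1 m + [:- c:]"
  have degp: "Polynomial.degree p = m"
    unfolding p_def using m0 by (subst degree_add_eq_left) (auto simp: degree_monom_eq)
  then have p0: "p \<noteq> 0"
    using m0 by auto
  have root: "poly p y = 0 \<longleftrightarrow> y ^ m = c" for y
    by (simp add: p_def poly_monom)
  obtain A where A: "size A = Polynomial.degree p" "p = smult (Polynomial.lead_coeff p) (\<Prod>x\<in>#A. [:-x, 1:])"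
    using alg_closed_imp_factorization[OF p0] by blast
  have roots: "set_mset A = {y. y ^ m = c}"
  proof -
    have "y \<in># A \<longleftrightarrow> poly p y = 0" for y
      by (subst A(2)) (use p0 in \<open>auto simp: poly_prod_mset prod_mset_zero_iff image_iff\<close>)
    then show ?thesis
      using root by auto
  qed
  have "count A y = 1" if "y \<in># A" for y
  proof (rule ccontr)
    assume "count A y \<noteq> 1"
    moreover have "0 < count A y"
      using that by simp
    ultimately have "2 \<le> count A y"
      by linarith
    then have "replicate_mset 2 y \<subseteq># A"
      by (simp add: count_le_replicate_mset_subset_eq)
    then have "[:-y, 1:] ^ 2 dvd (\<Prod>x\<in>#A. [:-x, 1:])"
      by (auto simp: mset_subset_eq_exists_conv)
    then have "[:-y, 1:] ^ 2 dvd p"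
      by (subst A(2)) (rule dvd_smult)
    then obtain q where q: "p = [:-y, 1:] * ([:-y, 1:] * q)"
      by (metis dvdE mult.assoc power2_eq_square)
    have "poly (pderiv p) y = 0"
      unfolding q pderiv_mult by simp
    then have "of_nat m * y ^ (m - 1) = 0"
      by (simp add: p_def pderiv_add pderiv_monom poly_monom)
    then have "y = 0"
      using m by auto
    then show False
      using that roots c m0 by auto
  qed
  then have "card (set_mset A) = size A"
    by (simp add: size_multiset_overloaded_eq)
  then show "card {y. y ^ m = c} = m"
    using A(1) degp roots by simp
  show "finite {y. y ^ m = c}"
    unfolding roots[symmetric] by simp
qed

locale finite_field_extension =
  fixes ty :: "'a::{finite, field} itself" and q l :: nat
  assumes q_def: "q = CARD('a)"
    and l_pos: "0 < l"
begin

lemma q_ge_2: "2 \<le> q"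
  unfolding q_def by (rule card_field_ge_2)

lemma exists_not_0_1:
  assumes "3 \<le> q"
  shows "\<exists>c :: 'a. c \<noteq> 0 \<and> c \<noteq> 1"
proof (rule ccontr)
  assume "\<not> ?thesis"
  then have "(UNIV :: 'a set) \<subseteq> {0, 1}"
    by blast
  then have "q \<le> card {0, 1 :: 'a}"
    unfolding q_def by (intro card_mono) auto
  then show False
    using assms by simp
qed

text \<open>Translation by \<open>1\<close> permutes the field, so the sum of all elements equals
  itself plus \<open>q\<close>.\<close>

lemma of_nat_card_field: "of_nat q = (0 :: 'a)"
proof -
  have "(\<Sum>x\<in>UNIV. x + 1) = (\<Sum>x\<in>(UNIV :: 'a set). x)"
    by (rule sum.reindex_bij_witness[of _ "\<lambda>x. x - 1" "\<lambda>x. x + 1"]) auto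
  then show ?thesis
    by (simp add: sum.distrib q_def)
qed

lemma power_card_field: "(x :: 'a) ^ q = x"
proof (cases "x = 0")
  case False
  have "x * (\<Prod>y\<in>UNIV - {0}. x * y) = x * x ^ (q - 1) * \<Prod>(UNIV - {0})"
    by (simp add: prod.distrib mult_ac q_def card_Diff_singleton)
  also have "x * x ^ (q - 1) = x ^ q"
    using q_ge_2 by (simp flip: power_Suc)
  also have "(\<Prod>y\<in>UNIV - {0}. x * y) = (\<Prod>y\<in>UNIV - {0}. y)"
    by (rule prod.reindex_bij_witness[of _ "\<lambda>y. y / x" "\<lambda>y. x * y"]) (use False in auto)
  finally show ?thesis
    by simp
qed (use q_ge_2 in auto)

lemma power_card_field_minus_1: "(x :: 'a) \<noteq> 0 \<Longrightarrow> x ^ (q - 1) = 1"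
  using power_card_field[of x] q_ge_2 by (simp add: power_eq_if split: if_splits)

text \<open>This gives additivity of the Frobenius map without reference to the characteristic: as
  \<open>(x + 1) ^ q = x + 1 = x ^ q + 1\<close> for all \<open>x\<close>, the middle binomial terms
  form a polynomial of degree below \<open>q\<close> with \<open>q\<close> roots.\<close>

lemma of_nat_choose_card_field:
  assumes "0 < k" "k < q"
  shows "of_nat (q choose k) = (0 :: 'a)"
proof -
  define P :: "'a poly" where "P = (\<Sum>i\<in>{0<..<q}. Polynomial.monom (of_nat (q choose i)) i)"
  have "poly P x = 0" for x
  proof -
    have "x + 1 = (x + 1) ^ q"
      by (rule power_card_field[symmetric])
    also have "\<dots> = (\<Sum>i\<le>q. of_nat (q choose i) * x ^ i)"
      by (simp add: binomial_ring)
    also have "{..q} = insert 0 (insert q {0<..<q})"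
      by auto
    also have "(\<Sum>i\<in>insert 0 (insert q {0<..<q}). of_nat (q choose i) * x ^ i) = 1 + (x ^ q + poly P x)"
      using q_ge_2 by (simp add: P_def poly_sum poly_monom)
    finally show ?thesis
      by (simp add: power_card_field)
  qed
  then have "{x. poly P x = 0} = UNIV"
    by auto
  moreover have "Polynomial.degree P \<le> q - 1"
    unfolding P_def
    by (intro degree_sum_le) (auto intro: order_trans[OF degree_monom_le])
  ultimately have "P = 0"
    using card_poly_roots_bound[of P] q_ge_2 by (fastforce simp: q_def)
  moreover have "Polynomial.coeff P k = of_nat (q choose k)"
    using assms by (simp add: P_def coeff_sum)
  ultimately show ?thesis
    by simp
qed

lemma frobenius_add: "(x + y :: 'a alg_closure) ^ q = x ^ q + y ^ q"
proof -
  have "(x + y) ^ q = (\<Sum>i\<le>q. of_nat (q choose i) * x ^ i * y ^ (q - i))"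
    by (rule binomial_ring)
  also have "\<dots> = (\<Sum>i\<in>{0, q}. of_nat (q choose i) * x ^ i * y ^ (q - i))"
  proof (intro sum.mono_neutral_right ballI)
    fix i assume "i \<in> {..q} - {0, q}"
    then have "to_ac (of_nat (q choose i) :: 'a) = 0"
      using of_nat_choose_card_field[of i] by simp
    then show "of_nat (q choose i) * x ^ i * y ^ (q - i) = 0"
      by simp
  qed auto
  finally show ?thesis
    using q_ge_2 by (simp add: add_ac)
qed

lemma frobenius_power_add: "(x + y :: 'a alg_closure) ^ (q ^ l) = x ^ (q ^ l) + y ^ (q ^ l)"
  by (induction l) (simp_all add: power_mult frobenius_add mult.commute[of q])

lemma frobenius_to_ac: "to_ac (c :: 'a) ^ q = to_ac c"
  by (simp add: power_card_field flip: to_ac_power)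

lemma frobenius_power_to_ac: "to_ac (c :: 'a) ^ (q ^ l) = to_ac c"
  by (induction l) (simp_all add: power_mult frobenius_to_ac mult.commute[of q])

text \<open>The subfield with \<open>q ^ l\<close> elements, as the fixed points of the iterated
  Frobenius map. As a set inside the algebraic closure it may depend on the number
  \<open>l\<close>.\<close>

definition ext_field :: "'a alg_closure set" where
  "ext_field = {x. x ^ (q ^ l) = x}"

text \<open>The number \<open>t\<close> as a natural number; on \<open>ext_field\<close> the power
  \<open>x ^ tnum\<close> is the norm down to \<open>'a\<close>.\<close>

definition tnum :: nat where
  "tnum = (\<Sum>i<l. q ^ i)"

lemma ext_add: "x \<in> ext_field \<Longrightarrow> y \<in> ext_field \<Longrightarrow> x + y \<in> ext_field"
  by (simp add: ext_field_def frobenius_power_add)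

lemma ext_mult: "x \<in> ext_field \<Longrightarrow> y \<in> ext_field \<Longrightarrow> x * y \<in> ext_field"
  by (simp add: ext_field_def power_mult_distrib)

lemma ext_to_ac: "to_ac c \<in> ext_field"
  by (simp add: ext_field_def frobenius_power_to_ac)

lemma ext_0: "0 \<in> ext_field" and ext_1: "1 \<in> ext_field"
  using ext_to_ac[of 0] ext_to_ac[of 1] by simp_all

lemma ext_minus: "x \<in> ext_field \<Longrightarrow> - x \<in> ext_field"
  using ext_mult[of "to_ac (-1)" x] ext_to_ac[of "-1"] by simp

lemma ext_diff: "x \<in> ext_field \<Longrightarrow> y \<in> ext_field \<Longrightarrow> x - y \<in> ext_field"
  using ext_add[of x "- y"] ext_minus by simp

lemma ext_divide: "x \<in> ext_field \<Longrightarrow> y \<in> ext_field \<Longrightarrow> x / y \<in> ext_field"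
  by (simp add: ext_field_def power_divide)

lemma ext_power: "x \<in> ext_field \<Longrightarrow> x ^ k \<in> ext_field"
  unfolding ext_field_def mem_Collect_eq by (metis mult.commute power_mult)

lemma ext_sum: "(\<And>i. i \<in> A \<Longrightarrow> f i \<in> ext_field) \<Longrightarrow> sum f A \<in> ext_field"
  by (induction A rule: infinite_finite_induct) (auto intro: ext_0 ext_add)

lemmas ext_closed = ext_0 ext_1 ext_add ext_mult ext_to_ac ext_minus ext_diff ext_divide ext_power

lemma tnum_eq: "(q - 1) * tnum = q ^ l - 1"
proof -
  obtain p where p: "q = Suc p"
    using q_ge_2 by (cases q) auto
  have "(q - 1) * (\<Sum>i<m. q ^ i) + 1 = q ^ m" for m
    by (induction m) (auto simp: p algebra_simps)
  from this[of l] show ?thesis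
    by (simp add: tnum_def)
qed

text \<open>\<open>q\<close> vanishes in the field, so only the summand \<open>q ^ 0\<close>
  survives. Hence \<open>card_nth_roots\<close> applies to the exponent \<open>tnum\<close>.\<close>

lemma of_nat_tnum: "of_nat tnum = (1 :: 'a alg_closure)"
proof -
  have q0: "of_nat q = (0 :: 'a alg_closure)"
    using arg_cong[OF of_nat_card_field, of to_ac] by simp
  have "of_nat tnum = (\<Sum>i<l. (0 :: 'a alg_closure) ^ i)"
    by (simp add: tnum_def q0)
  also have "\<dots> = (\<Sum>i\<in>{0}. 0 ^ i)"
    using l_pos by (intro sum.mono_neutral_right) auto
  finally show ?thesis
    by simp
qed

lemma ext_iff_power: "x \<noteq> 0 \<Longrightarrow> x \<in> ext_field \<longleftrightarrow> x ^ (q ^ l - 1) = 1"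
  using q_ge_2 by (simp add: ext_field_def power_eq_if[of x "q ^ l"])

text \<open>The nonzero elements are the solutions of \<open>x ^ (q ^ l - 1) = 1\<close>, and this
  exponent is \<open>-1\<close> in the field, so \<open>card_nth_roots\<close> counts them.\<close>

lemma card_ext: "card ext_field = q ^ l" "finite ext_field"
proof -
  have "of_nat (q ^ l) = (0 :: 'a alg_closure)"
    using arg_cong[OF of_nat_card_field, of to_ac] by (simp add: l_pos)
  then have "of_nat (q ^ l - 1) = (- 1 :: 'a alg_closure)"
    using q_ge_2 by (simp add: of_nat_diff)
  then have c: "card {x :: 'a alg_closure. x ^ (q ^ l - 1) = 1} = q ^ l - 1"
      "finite {x :: 'a alg_closure. x ^ (q ^ l - 1) = 1}"
    by (intro card_nth_roots; simp)+
  have "1 < q ^ l"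
    using q_ge_2 l_pos by (intro one_less_power) auto
  then have "x \<in> ext_field \<longleftrightarrow> x \<in> insert 0 {x. x ^ (q ^ l - 1) = 1}" for x
    using ext_iff_power[of x] ext_0 by (cases "x = 0") auto
  then have "ext_field = insert 0 {x. x ^ (q ^ l - 1) = 1}"
    by blast
  moreover have "0 \<notin> {x :: 'a alg_closure. x ^ (q ^ l - 1) = 1}"
    using \<open>1 < q ^ l\<close> by (simp add: power_0_left)
  ultimately show "card ext_field = q ^ l" "finite ext_field"
    using c \<open>1 < q ^ l\<close> by simp_all
qed

section \<open>Norm circles\<close>

definition norm_circle :: "'a alg_closure \<Rightarrow> 'a \<Rightarrow> 'a alg_closure set" where
  "norm_circle \<alpha> c = {z. (z - \<alpha>) ^ tnum = to_ac c}"

lemma tnum_pos: "0 < tnum"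
  using l_pos q_ge_2 unfolding tnum_def by (intro sum_pos) auto

lemma card_norm_circle:
  assumes "c \<noteq> 0"
  shows "card (norm_circle \<alpha> c) = tnum" "finite (norm_circle \<alpha> c)"
proof -
  have "of_nat tnum \<noteq> (0 :: 'a alg_closure)" "to_ac c \<noteq> 0"
    using assms by (simp_all add: of_nat_tnum)
  note roots = card_nth_roots[OF this]
  have eq: "norm_circle \<alpha> c = (+) \<alpha> ` {y. y ^ tnum = to_ac c}"
    unfolding norm_circle_def by (force intro: image_eqI[where x = "_ - \<alpha>"])
  show "card (norm_circle \<alpha> c) = tnum" "finite (norm_circle \<alpha> c)"
    unfolding eq using roots by (simp_all add: card_image)
qed

text \<open>Since \<open>(q - 1) * tnum = q ^ l - 1\<close>, the element satisfies
  \<open>y ^ (q ^ l - 1) = c ^ (q - 1) = 1\<close>.\<close>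

lemma in_ext_if_norm:
  assumes "c \<noteq> 0" and y: "y ^ tnum = to_ac c"
  shows "y \<in> ext_field"
proof -
  have "y \<noteq> 0"
    using assms tnum_pos by (auto simp: power_0_left)
  moreover have "y ^ (q ^ l - 1) = 1"
    unfolding tnum_eq[symmetric] mult.commute[of "q - 1"] power_mult y
    using power_card_field_minus_1[OF assms(1)] by (simp flip: to_ac_power)
  ultimately show ?thesis
    by (simp add: ext_iff_power)
qed

lemma norm_circle_subset:
  assumes "c \<noteq> 0" "\<alpha> \<in> ext_field"
  shows "norm_circle \<alpha> c \<subseteq> ext_field"
proof
  fix z assume "z \<in> norm_circle \<alpha> c"
  then have "z - \<alpha> \<in> ext_field"
    using in_ext_if_norm[OF assms(1)] by (simp add: norm_circle_def)
  then show "z \<in> ext_field"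
    using ext_add[OF _ assms(2)] by fastforce
qed

lemma exists_norm: "\<exists>\<beta>. \<beta> ^ tnum = to_ac c"
  using nth_root_exists[OF tnum_pos] .

text \<open>The link between repair kernels and circles. Division by \<open>x\<close> turns the
  equation into \<open>z - \<alpha> = \<beta> * x ^ (q - 1)\<close>, and the powers
  \<open>x ^ (q - 1)\<close> of nonzero elements of \<open>ext_field\<close> are exactly the
  elements of norm \<open>1\<close>.\<close>

lemma norm_circle_iff:
  assumes c: "c \<noteq> 0" and \<beta>: "\<beta> ^ tnum = to_ac c"
  shows "z \<in> norm_circle \<alpha> c \<longleftrightarrow> (\<exists>x\<in>ext_field. x \<noteq> 0 \<and> \<alpha> * x + \<beta> * x ^ q = z * x)"
proof
  have \<beta>0: "\<beta> \<noteq> 0"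
    using assms tnum_pos by (auto simp: power_0_left)
  have q1: "0 < q - 1"
    using q_ge_2 by simp
  have pq: "x ^ q = x ^ (q - 1) * x" for x :: "'a alg_closure"
    using q_ge_2 by (metis One_nat_def Suc_pred less_le_trans power_Suc2 zero_less_numeral)
  have root: "x ^ (q ^ l - 1) = (x ^ (q - 1)) ^ tnum" for x :: "'a alg_closure"
    by (metis tnum_eq power_mult)
  {
    assume "z \<in> norm_circle \<alpha> c"
    then have "((z - \<alpha>) / \<beta>) ^ tnum = 1"
      using \<beta> c by (simp add: norm_circle_def power_divide)
    \<comment> \<open>The root is taken in the algebraic closure; norm \<open>1\<close> of its power
      then puts it into \<open>ext_field\<close>, as in Hilbert 90.\<close>
    moreover obtain x where x: "x ^ (q - 1) = (z - \<alpha>) / \<beta>"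
      using nth_root_exists[OF q1] by blast
    ultimately have x1: "x ^ (q ^ l - 1) = 1"
      by (metis root)
    have "1 < q ^ l"
      using q_ge_2 l_pos by (intro one_less_power) auto
    then have "x \<noteq> 0"
      using x1 by (auto simp: power_0_left split: if_splits)
    moreover have "\<alpha> * x + \<beta> * x ^ q = z * x"
      unfolding pq x using \<beta>0 by (simp add: field_simps)
    ultimately show "\<exists>x\<in>ext_field. x \<noteq> 0 \<and> \<alpha> * x + \<beta> * x ^ q = z * x"
      using x1 ext_iff_power by blast
  }
  assume "\<exists>x\<in>ext_field. x \<noteq> 0 \<and> \<alpha> * x + \<beta> * x ^ q = z * x"
  then obtain x where x: "x \<in> ext_field" "x \<noteq> 0" "\<alpha> * x + \<beta> * x ^ q = z * x"
    by blast
  then have "(z - \<alpha>) * x = \<beta> * x ^ (q - 1) * x"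
    by (simp add: pq algebra_simps)
  then have "z - \<alpha> = \<beta> * x ^ (q - 1)"
    using x(2) by simp
  moreover have "(x ^ (q - 1)) ^ tnum = 1"
    using ext_iff_power[OF x(2)] x(1) root by metis
  ultimately show "z \<in> norm_circle \<alpha> c"
    using \<beta> by (simp add: norm_circle_def power_mult_distrib)
qed

section \<open>Bases of the extension over the ground field\<close>

definition lin_comb :: "(nat \<Rightarrow> 'a alg_closure) \<Rightarrow> nat \<Rightarrow> (nat \<Rightarrow> 'a) \<Rightarrow> 'a alg_closure" where
  "lin_comb b m c = (\<Sum>i<m. to_ac (c i) * b i)"

definition independent :: "nat \<Rightarrow> (nat \<Rightarrow> 'a alg_closure) \<Rightarrow> bool" where
  "independent m b \<longleftrightarrow> (\<forall>i<m. b i \<in> ext_field) \<and> (\<forall>c. lin_comb b m c = 0 \<longrightarrow> (\<forall>i<m. c i = 0))"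

lemma lin_comb_cong: "(\<And>i. i < m \<Longrightarrow> c i = c' i) \<Longrightarrow> (\<And>i. i < m \<Longrightarrow> b i = b' i) \<Longrightarrow> lin_comb b m c = lin_comb b' m c'"
  by (simp add: lin_comb_def)

lemma lin_comb_diff: "lin_comb b m (\<lambda>i. c i - c' i) = lin_comb b m c - lin_comb b m c'"
  by (simp add: lin_comb_def left_diff_distrib sum_subtractf)

lemma lin_comb_in_ext: "independent m b \<Longrightarrow> lin_comb b m c \<in> ext_field"
  unfolding lin_comb_def independent_def by (auto intro!: ext_sum ext_mult ext_to_ac)

lemma independent_inj:
  assumes "independent m b" "lin_comb b m c = lin_comb b m c'" "i < m"
  shows "c i = c' i"
proof -
  have "lin_comb b m (\<lambda>i. c i - c' i) = 0"
    using assms(2) by (simp add: lin_comb_diff)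
  then show ?thesis
    using assms(1,3) unfolding independent_def by force
qed

lemma card_lin_comb:
  assumes "independent m b"
  shows "card (lin_comb b m ` ({..<m} \<rightarrow>\<^sub>E UNIV)) = q ^ m"
proof -
  have "inj_on (lin_comb b m) ({..<m} \<rightarrow>\<^sub>E UNIV)"
    by (intro inj_onI PiE_ext) (auto dest: independent_inj[OF assms])
  then show ?thesis
    by (simp add: card_image card_funcsetE q_def)
qed

text \<open>Counting replaces dimension theory: \<open>l\<close> independent elements have
  \<open>q ^ l\<close> distinct combinations, as many as \<open>ext_field\<close> has
  elements.\<close>

lemma basis_surj:
  assumes b: "independent l b" and x: "x \<in> ext_field"
  shows "\<exists>c. x = lin_comb b l c"
proof -
  have "lin_comb b l ` ({..<l} \<rightarrow>\<^sub>E UNIV) = ext_field"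
    using card_lin_comb[OF b] card_ext lin_comb_in_ext[OF b] by (intro card_subset_eq) auto
  then show ?thesis
    using x by blast
qed

text \<open>The \<open>q ^ m\<close> combinations cannot exhaust the \<open>q ^ l\<close> elements
  of \<open>ext_field\<close>, and any element left over extends the sequence.\<close>

lemma independent_extend:
  assumes b: "independent m b" and "m < l"
  shows "\<exists>x. independent (Suc m) (b(m := x))"
proof -
  have "q ^ m < q ^ l"
    using q_ge_2 assms(2) by (intro power_strict_increasing) auto
  moreover have "finite (lin_comb b m ` ({..<m} \<rightarrow>\<^sub>E UNIV))"
    by (intro finite_imageI finite_PiE) auto
  ultimately have "\<not> ext_field \<subseteq> lin_comb b m ` ({..<m} \<rightarrow>\<^sub>E UNIV)"
    using card_mono[of "lin_comb b m ` ({..<m} \<rightarrow>\<^sub>E UNIV)" ext_field] card_lin_comb[OF b] card_ext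
    by auto
  then obtain x where x: "x \<in> ext_field" "x \<notin> lin_comb b m ` ({..<m} \<rightarrow>\<^sub>E UNIV)"
    by blast
  have x': "x \<noteq> lin_comb b m c" for c
  proof
    assume "x = lin_comb b m c"
    also have "\<dots> = lin_comb b m (restrict c {..<m})"
      by (rule lin_comb_cong) auto
    finally show False
      using x(2) by (auto intro!: image_eqI[where x = "restrict c {..<m}"])
  qed
  have "independent (Suc m) (b(m := x))"
    unfolding independent_def
  proof (intro conjI allI impI)
    fix i assume "i < Suc m"
    then show "(b(m := x)) i \<in> ext_field"
      using x b by (auto simp: independent_def less_Suc_eq)
  next
    fix c i assume 0: "lin_comb (b(m := x)) (Suc m) c = 0" and i: "i < Suc m"
    have sum: "lin_comb b m c + to_ac (c m) * x = 0"
      using 0 by (simp add: lin_comb_def)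
    have "c m = 0"
    proof (rule ccontr)
      assume cm: "c m \<noteq> 0"
      have "x = lin_comb b m (\<lambda>i. - c i / c m)"
      proof -
        have "to_ac (c m) * lin_comb b m (\<lambda>i. - c i / c m) = - lin_comb b m c"
          unfolding lin_comb_def sum_distrib_left sum_negf[symmetric]
          using cm by (intro sum.cong) auto
        also have "\<dots> = to_ac (c m) * x"
          using sum by (simp add: add_eq_0_iff2)
        finally show ?thesis
          using cm by simp
      qed
      then show False
        using x' by blast
    qed
    moreover from this have "lin_comb b m c = 0"
      using sum by simp
    ultimately show "c i = 0"
      using b i by (auto simp: independent_def less_Suc_eq)
  qed
  then show ?thesis
    by blast
qed

lemma basis_extending:
  assumes "independent m b" "m \<le> l"
  shows "\<exists>b'. independent l b' \<and> (\<forall>i<m. b' i = b i)"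
  using assms
proof (induction "l - m" arbitrary: m b)
  case 0
  then show ?case
    by auto
next
  case (Suc k)
  have "m < l"
    using Suc.hyps(2) by simp
  then obtain x where x: "independent (Suc m) (b(m := x))"
    using independent_extend[OF Suc.prems(1)] by blast
  have "k = l - Suc m" "Suc m \<le> l"
    using Suc.hyps(2) by simp_all
  then obtain b' where b': "independent l b'" "\<forall>i<Suc m. b' i = (b(m := x)) i"
    using Suc.hyps(1)[OF _ x] by blast
  then have "b' i = b i" if "i < m" for i
    using that b'(2)[rule_format, of i] by simp
  then show ?case
    using b'(1) by blast
qed

lemma independent_singleton:
  assumes "x \<in> ext_field" "x \<noteq> 0"
  shows "independent 1 (\<lambda>_. x)"
  using assms by (auto simp: independent_def lin_comb_def)

lemma independent_pair:
  assumes "x \<in> ext_field" "x \<noteq> 0" "y \<in> ext_field" "\<And>c. y \<noteq> to_ac c * x"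
  shows "independent 2 (\<lambda>i. if i = 0 then x else y)"
  unfolding independent_def
proof (intro conjI allI impI)
  fix c i assume "lin_comb (\<lambda>i. if i = 0 then x else y) 2 c = 0" and i: "i < (2::nat)"
  then have sum: "to_ac (c 0) * x + to_ac (c 1) * y = 0"
    by (simp add: lin_comb_def numeral_2_eq_2)
  have c1: "c 1 = 0"
  proof (rule ccontr)
    assume "c 1 \<noteq> 0"
    then have "y = to_ac (- c 0 / c 1) * x"
      using sum by (simp add: field_simps add_eq_0_iff2)
    then show False
      using assms(4) by blast
  qed
  then have "c 0 = 0"
    using sum assms(2) by simp
  with c1 i show "c i = 0"
    by (auto simp: less_2_cases_iff)
qed (use assms in auto)

subsection \<open>Codes from lines in the plane over the extension field\<close>

definition coord :: "(nat \<Rightarrow> 'a alg_closure) \<Rightarrow> 'a alg_closure \<Rightarrow> nat \<Rightarrow> 'a" where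
  "coord b x = (SOME c. x = lin_comb b l c)"

lemma lin_comb_coord:
  assumes "independent l b" "x \<in> ext_field"
  shows "lin_comb b l (coord b x) = x"
  unfolding coord_def using someI_ex[OF basis_surj[OF assms]] by simp

text \<open>Lets a matrix with columns \<open>coord b (x k)\<close> be read as the
  \<open>'a\<close>-linear map that sends the \<open>k\<close>-th unit vector to \<open>x k\<close>,
  so that products are computed in \<open>ext_field\<close>.\<close>

lemma lin_comb_mult_matrix:
  assumes b: "independent l b" and x: "\<And>k. k < m \<Longrightarrow> x k \<in> ext_field"
  shows "lin_comb b l (\<lambda>r. \<Sum>k<m. coord b (x k) r * v k) = (\<Sum>k<m. to_ac (v k) * x k)"
proof -
  have "lin_comb b l (\<lambda>r. \<Sum>k<m. coord b (x k) r * v k)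
      = (\<Sum>r<l. \<Sum>k<m. to_ac (v k) * (to_ac (coord b (x k) r) * b r))"
    unfolding lin_comb_def to_ac_sum sum_distrib_right by (intro sum.cong refl) (simp add: mult_ac)
  also have "\<dots> = (\<Sum>k<m. \<Sum>r<l. to_ac (v k) * (to_ac (coord b (x k) r) * b r))"
    by (rule sum.swap)
  also have "\<dots> = (\<Sum>k<m. to_ac (v k) * lin_comb b l (coord b (x k)))"
    by (simp add: lin_comb_def sum_distrib_left)
  also have "\<dots> = (\<Sum>k<m. to_ac (v k) * x k)"
    by (intro sum.cong refl) (simp add: lin_comb_coord[OF b x])
  finally show ?thesis .
qed

text \<open>A linearized polynomial: \<open>'a\<close>-linear by the Frobenius map, but in general
  not linear over \<open>ext_field\<close>, so that its graph can meet many lines through the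
  origin.\<close>

definition qlin :: "'a alg_closure \<Rightarrow> 'a alg_closure \<Rightarrow> 'a alg_closure \<Rightarrow> 'a alg_closure" where
  "qlin \<alpha> \<beta> x = \<alpha> * x + \<beta> * x ^ q"

lemma qlin_add: "qlin \<alpha> \<beta> (x + y) = qlin \<alpha> \<beta> x + qlin \<alpha> \<beta> y"
  by (simp add: qlin_def frobenius_add algebra_simps)

lemma qlin_0 [simp]: "qlin \<alpha> \<beta> 0 = 0"
  using q_ge_2 by (simp add: qlin_def power_0_left)

lemma qlin_scale: "qlin \<alpha> \<beta> (to_ac c * x) = to_ac c * qlin \<alpha> \<beta> x"
  by (simp add: qlin_def power_mult_distrib frobenius_to_ac algebra_simps)

lemma qlin_lin_comb: "qlin \<alpha> \<beta> (lin_comb b m c) = (\<Sum>i<m. to_ac (c i) * qlin \<alpha> \<beta> (b i))"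
  unfolding lin_comb_def by (induction m) (simp_all add: qlin_add qlin_scale)

lemma qlin_in_ext: "\<alpha> \<in> ext_field \<Longrightarrow> \<beta> \<in> ext_field \<Longrightarrow> x \<in> ext_field \<Longrightarrow> qlin \<alpha> \<beta> x \<in> ext_field"
  unfolding qlin_def by (intro ext_closed)

lemma independent_zero_iff:
  assumes "independent l b" "v \<in> carrier_vec l"
  shows "lin_comb b l (vec_index v) = 0 \<longleftrightarrow> v = 0\<^sub>v l"
proof
  assume "lin_comb b l (vec_index v) = 0"
  then show "v = 0\<^sub>v l"
    using assms by (intro eq_vecI) (auto simp: independent_def)
qed (simp add: lin_comb_def)

text \<open>
  Node \<open>j\<close> is the line of \<open>ext_field\<^sup>2\<close> spanned by \<open>(p j, s j)\<close>, with the \<open>'a\<close>-basis obtained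
  from the basis \<open>e j\<close> of \<open>ext_field\<close>.
\<close>
definition code_mat where
  "code_mat b p s e n = mat (2 * l) (n * l) (\<lambda>(r, c).
     if r < l then coord b (p (c div l) * e (c div l) (c mod l)) r
     else coord b (s (c div l) * e (c div l) (c mod l)) (r - l))"

text \<open>The repair matrix with kernel \<open>{(x, qlin \<alpha> \<beta> x) | x \<in> ext_field}\<close>.\<close>
definition repair_mat where
  "repair_mat b \<alpha> \<beta> = mat l (2 * l) (\<lambda>(r, c).
     if c < l then coord b (- qlin \<alpha> \<beta> (b c)) r else coord b (b (c - l)) r)"

lemma code_mat_carrier: "code_mat b p s e n \<in> carrier_mat (2 * l) (n * l)"
  by (simp add: code_mat_def)

lemma repair_mat_carrier: "repair_mat b \<alpha> \<beta> \<in> carrier_mat l (2 * l)"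
  by (simp add: repair_mat_def)

text \<open>The column space of block \<open>j\<close> is thus the line through
  \<open>(p j, s j)\<close>, whichever basis \<open>e j\<close> is chosen; the basis only decides
  which vectors of the line are columns.\<close>

lemma block_code_mat_vec:
  assumes b: "independent l b" and e: "independent l (e j)" and j: "j < n"
    and ps: "p j \<in> ext_field" "s j \<in> ext_field" and v: "v \<in> carrier_vec l"
  defines "u \<equiv> block l (code_mat b p s e n) j *\<^sub>v v"
  shows "lin_comb b l (vec_index u) = p j * lin_comb (e j) l (vec_index v)"
    and "lin_comb b l (\<lambda>r. vec_index u (l + r)) = s j * lin_comb (e j) l (vec_index v)"
proof -
  have ei: "e j k \<in> ext_field" if "k < l" for k
    using e that by (simp add: independent_def)
  have idx: "j * l + k < n * l" if "k < l" for k
    using block_index_less[OF j that] .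
  have u: "u $ r = (\<Sum>k<l. code_mat b p s e n $$ (r, j * l + k) * v $ k)" if "r < 2 * l" for r
    using that v by (simp add: u_def block_def code_mat_def scalar_prod_def atLeast0LessThan)
  have "lin_comb b l (vec_index u) = lin_comb b l (\<lambda>r. \<Sum>k<l. coord b (p j * e j k) r * v $ k)"
    by (rule lin_comb_cong) (auto simp: u code_mat_def idx)
  also have "\<dots> = (\<Sum>k<l. to_ac (v $ k) * (p j * e j k))"
    by (rule lin_comb_mult_matrix[OF b]) (intro ext_mult ps ei)
  finally show "lin_comb b l (vec_index u) = p j * lin_comb (e j) l (vec_index v)"
    by (simp add: lin_comb_def sum_distrib_left mult_ac)
  have "lin_comb b l (\<lambda>r. vec_index u (l + r)) = lin_comb b l (\<lambda>r. \<Sum>k<l. coord b (s j * e j k) r * v $ k)"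
    by (rule lin_comb_cong) (auto simp: u code_mat_def idx)
  also have "\<dots> = (\<Sum>k<l. to_ac (v $ k) * (s j * e j k))"
    by (rule lin_comb_mult_matrix[OF b]) (intro ext_mult ps ei)
  finally show "lin_comb b l (\<lambda>r. vec_index u (l + r)) = s j * lin_comb (e j) l (vec_index v)"
    by (simp add: lin_comb_def sum_distrib_left mult_ac)
qed

text \<open>Confirms that the kernel is the graph of \<open>qlin \<alpha> \<beta>\<close>: the first
  \<open>l\<close> columns contribute \<open>- qlin \<alpha> \<beta>\<close>, the last
  \<open>l\<close> the identity.\<close>

lemma repair_mat_vec:
  assumes b: "independent l b" and \<alpha>\<beta>: "\<alpha> \<in> ext_field" "\<beta> \<in> ext_field" and u: "u \<in> carrier_vec (2 * l)"
  shows "lin_comb b l (vec_index (repair_mat b \<alpha> \<beta> *\<^sub>v u))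
    = lin_comb b l (\<lambda>r. vec_index u (l + r)) - qlin \<alpha> \<beta> (lin_comb b l (vec_index u))"
proof -
  have bi: "b k \<in> ext_field" if "k < l" for k
    using b that by (simp add: independent_def)
  define x where "x c = (if c < l then - qlin \<alpha> \<beta> (b c) else b (c - l))" for c
  have x: "x c \<in> ext_field" if "c < 2 * l" for c
    using that by (auto simp: x_def intro!: ext_minus qlin_in_ext \<alpha>\<beta> bi)
  have split: "(\<Sum>c<l + m. g c) = (\<Sum>c<l. g c) + (\<Sum>c<m. g (l + c))" for g :: "nat \<Rightarrow> 'a alg_closure" and m
    by (induction m) (simp_all add: add.assoc)
  have "lin_comb b l (vec_index (repair_mat b \<alpha> \<beta> *\<^sub>v u))
      = lin_comb b l (\<lambda>r. \<Sum>c<2 * l. coord b (x c) r * u $ c)"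
  proof (rule lin_comb_cong)
    fix r assume "r < l"
    then show "(repair_mat b \<alpha> \<beta> *\<^sub>v u) $ r = (\<Sum>c<2 * l. coord b (x c) r * u $ c)"
      using u by (simp add: repair_mat_def scalar_prod_def atLeast0LessThan x_def if_distrib
          cong: if_cong sum.cong) (intro sum.cong, auto)
  qed simp
  also have "\<dots> = (\<Sum>c<2 * l. to_ac (u $ c) * x c)"
    by (rule lin_comb_mult_matrix[OF b x])
  also have "\<dots> = (\<Sum>c<l + l. to_ac (u $ c) * x c)"
    by (simp add: mult_2)
  also have "\<dots> = (\<Sum>c<l. to_ac (u $ c) * x c) + (\<Sum>c<l. to_ac (u $ (l + c)) * x (l + c))"
    by (rule split)
  also have "\<dots> = lin_comb b l (\<lambda>r. vec_index u (l + r)) - qlin \<alpha> \<beta> (lin_comb b l (vec_index u))"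
    unfolding qlin_lin_comb by (simp add: x_def lin_comb_def sum_negf)
  finally show ?thesis .
qed

text \<open>Cramer's rule: \<open>distinct\<close> says that the determinant of
  \<open>(p i, s i)\<close> and \<open>(p j, s j)\<close> is nonzero, so the two lines meet only in
  the origin.\<close>

lemma blocks_independent_code_mat:
  assumes b: "independent l b" and e: "\<And>j. j < n \<Longrightarrow> independent l (e j)"
    and ps: "\<And>j. j < n \<Longrightarrow> p j \<in> ext_field \<and> s j \<in> ext_field"
    and distinct: "\<And>i j. i < n \<Longrightarrow> j < n \<Longrightarrow> i \<noteq> j \<Longrightarrow> p i * s j \<noteq> p j * s i"
  shows "blocks_independent n l (code_mat b p s e n)"
  unfolding blocks_independent_def
proof (intro allI impI ballI)
  fix i j and v w :: "'a vec"
  assume ij: "i < n" "j < n" "i \<noteq> j" and v: "v \<in> carrier_vec l" and w: "w \<in> carrier_vec l"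
  define H where "H = code_mat b p s e n"
  assume "block l (code_mat b p s e n) i *\<^sub>v v + block l (code_mat b p s e n) j *\<^sub>v w
    = 0\<^sub>v (dim_row (code_mat b p s e n))"
  then have 0: "block l H i *\<^sub>v v + block l H j *\<^sub>v w = 0\<^sub>v (2 * l)"
    by (simp add: H_def code_mat_def)
  have B: "block l H k \<in> carrier_mat (2 * l) l" for k
    unfolding H_def by (rule block_carrier[OF code_mat_carrier])
  define xv yw where "xv = lin_comb (e i) l (vec_index v)" and "yw = lin_comb (e j) l (vec_index w)"
  have entry: "(block l H i *\<^sub>v v) $ r = - (block l H j *\<^sub>v w) $ r" if "r < 2 * l" for r
  proof -
    have "(block l H i *\<^sub>v v) $ r + (block l H j *\<^sub>v w) $ r = 0"
      using arg_cong[OF 0, of "\<lambda>u. vec_index u r"] that carrier_matD(1)[OF B[of j]] by simp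
    then show ?thesis
      by (simp add: add_eq_0_iff2)
  qed
  have neg: "lin_comb b l (\<lambda>r. - c r) = - lin_comb b l c" for c
    by (simp add: lin_comb_def sum_negf)
  have "lin_comb b l (vec_index (block l H i *\<^sub>v v)) = - lin_comb b l (vec_index (block l H j *\<^sub>v w))"
    unfolding neg[symmetric] by (rule lin_comb_cong) (auto simp: entry)
  then have 1: "p i * xv = - (p j * yw)"
    using block_code_mat_vec(1)[where e = e, OF b e[OF ij(1)] ij(1) _ _ v]
      block_code_mat_vec(1)[where e = e, OF b e[OF ij(2)] ij(2) _ _ w] ps ij
    unfolding H_def xv_def yw_def by metis
  have "lin_comb b l (\<lambda>r. vec_index (block l H i *\<^sub>v v) (l + r)) = - lin_comb b l (\<lambda>r. vec_index (block l H j *\<^sub>v w) (l + r))"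
    unfolding neg[symmetric] by (rule lin_comb_cong) (auto simp: entry)
  then have 2: "s i * xv = - (s j * yw)"
    using block_code_mat_vec(2)[where e = e, OF b e[OF ij(1)] ij(1) _ _ v]
      block_code_mat_vec(2)[where e = e, OF b e[OF ij(2)] ij(2) _ _ w] ps ij
    unfolding H_def xv_def yw_def by metis
  have "(p i * s j - p j * s i) * xv = s j * (p i * xv) - p j * (s i * xv)"
    by (simp add: algebra_simps)
  also have "\<dots> = 0"
    unfolding 1 2 by simp
  finally have xv: "xv = 0"
    using distinct[OF ij] by simp
  \<comment> \<open>\<open>p j\<close> and \<open>s j\<close> cannot both be zero, or the
    determinant would vanish.\<close>
  have yw: "yw = 0"
    using 1 2 xv distinct[OF ij] by auto
  show "v = 0\<^sub>v l \<and> w = 0\<^sub>v l"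
    using xv yw independent_zero_iff e ij v w unfolding xv_def yw_def by metis
qed

lemma repair_mat_block_vec:
  assumes b: "independent l b" and e: "independent l (e j)" and j: "j < n"
    and ps: "p j \<in> ext_field" "s j \<in> ext_field" and v: "v \<in> carrier_vec l"
    and \<alpha>\<beta>: "\<alpha> \<in> ext_field" "\<beta> \<in> ext_field"
  defines "xv \<equiv> lin_comb (e j) l (vec_index v)"
  shows "(repair_mat b \<alpha> \<beta> * block l (code_mat b p s e n) j) *\<^sub>v v = 0\<^sub>v l
    \<longleftrightarrow> s j * xv = qlin \<alpha> \<beta> (p j * xv)"
proof -
  have B: "block l (code_mat b p s e n) j \<in> carrier_mat (2 * l) l"
    by (rule block_carrier[OF code_mat_carrier])
  define u where "u = block l (code_mat b p s e n) j *\<^sub>v v"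
  have u: "u \<in> carrier_vec (2 * l)"
    using B v by (simp add: u_def)
  have Mu: "repair_mat b \<alpha> \<beta> *\<^sub>v u \<in> carrier_vec l"
    by (rule mult_mat_vec_carrier[OF repair_mat_carrier u])
  have "(repair_mat b \<alpha> \<beta> * block l (code_mat b p s e n) j) *\<^sub>v v = repair_mat b \<alpha> \<beta> *\<^sub>v u"
    unfolding u_def by (rule assoc_mult_mat_vec[OF repair_mat_carrier B v])
  then show ?thesis
    using independent_zero_iff[OF b Mu] repair_mat_vec[OF b \<alpha>\<beta> u]
      block_code_mat_vec[where e = e and p = p and s = s and j = j, OF b e j ps v] unfolding u_def xv_def by simp
qed

text \<open>For each node \<open>i\<close> a graph must miss line \<open>i\<close>, which makes
  \<open>M * block l H i\<close> invertible, and contain a chosen basis vector of at least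
  \<open>tnum\<close> helpers; each of these vectors turns into a zero column and saves one
  symbol.\<close>

lemma exists_optimal_code:
  fixes e :: "nat \<Rightarrow> nat \<Rightarrow> 'a alg_closure"
  assumes n: "3 \<le> n" and e: "\<And>j. j < n \<Longrightarrow> independent l (e j)"
    and ps: "\<And>j. j < n \<Longrightarrow> p j \<in> ext_field \<and> s j \<in> ext_field"
    and distinct: "\<And>i j. i < n \<Longrightarrow> j < n \<Longrightarrow> i \<noteq> j \<Longrightarrow> p i * s j \<noteq> p j * s i"
    and repair: "\<And>i. i < n \<Longrightarrow> \<exists>\<alpha>\<in>ext_field. \<exists>\<beta>\<in>ext_field.
      (\<forall>x\<in>ext_field. s i * x = qlin \<alpha> \<beta> (p i * x) \<longrightarrow> x = 0) \<and>
      tnum \<le> card {j \<in> {..<n} - {i}. \<exists>k<l. s j * e j k = qlin \<alpha> \<beta> (p j * e j k)}"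
  shows "\<exists>C :: 'a vec set. mds_code_saving n l tnum C"
proof -
  \<comment> \<open>Any basis of \<open>ext_field\<close> can serve for the row coordinates.\<close>
  define b where "b = e 0"
  have b: "independent l b"
    using e n by (simp add: b_def)
  define H where "H = code_mat b p s e n"
  have H: "H \<in> carrier_mat (2 * l) (n * l)"
    by (simp add: H_def code_mat_carrier)
  have tn: "tnum \<le> l * (n - 1)"
  proof -
    have n0: "0 < n"
      using n by simp
    obtain \<alpha> \<beta> where "tnum \<le> card {j \<in> {..<n} - {0}. \<exists>k<l. s j * e j k = qlin \<alpha> \<beta> (p j * e j k)}"
      using repair[OF n0] by blast
    also have "\<dots> \<le> card ({..<n} - {0})"
      by (intro card_mono) auto
    also have "\<dots> = n - 1"
      using n0 by simp
    also have "\<dots> \<le> l * (n - 1)"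
      using l_pos by simp
    finally show ?thesis .
  qed
  have "\<exists>M\<in>repair_mats 2 l H i. repair_io n l H i M + tnum \<le> l * (n - 1)" if i: "i < n" for i
  proof -
    obtain \<alpha> \<beta> where \<alpha>\<beta>: "\<alpha> \<in> ext_field" "\<beta> \<in> ext_field"
      and inj: "\<And>x. x \<in> ext_field \<Longrightarrow> s i * x = qlin \<alpha> \<beta> (p i * x) \<Longrightarrow> x = 0"
      and card: "tnum \<le> card {j \<in> {..<n} - {i}. \<exists>k<l. s j * e j k = qlin \<alpha> \<beta> (p j * e j k)}"
      using repair[OF i] by blast
    define M where "M = repair_mat b \<alpha> \<beta>"
    define T where "T = {j \<in> {..<n} - {i}. \<exists>k<l. s j * e j k = qlin \<alpha> \<beta> (p j * e j k)}"
    have MB: "M * block l H j \<in> carrier_mat l l" for j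
      using repair_mat_carrier block_carrier[OF H, of l j] unfolding M_def by (metis mult_carrier_mat)
    have MB0: "(M * block l H j) *\<^sub>v v = 0\<^sub>v l
        \<longleftrightarrow> s j * lin_comb (e j) l (vec_index v) = qlin \<alpha> \<beta> (p j * lin_comb (e j) l (vec_index v))"
      if "j < n" "v \<in> carrier_vec l" for j v
      unfolding M_def H_def using repair_mat_block_vec[where e = e and p = p and s = s and j = j, OF b e[OF that(1)] that(1) _ _ that(2) \<alpha>\<beta>] ps[OF that(1)] by blast
    have "M \<in> repair_mats 2 l H i"
      unfolding repair_mats_def
    proof (intro CollectI conjI)
      show "M \<in> carrier_mat l (2 * l)"
        by (simp add: M_def repair_mat_carrier)
      show "invertible_mat (M * block l H i)"
        unfolding invertible_mat_iff_inj[OF MB]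
      proof safe
        fix v assume v: "v \<in> carrier_vec l" "(M * block l H i) *\<^sub>v v = 0\<^sub>v l"
        have "lin_comb (e i) l (vec_index v) = 0"
          using inj[OF lin_comb_in_ext[OF e[OF i]]] MB0[OF i v(1)] v(2) by blast
        then show "v = 0\<^sub>v l"
          using independent_zero_iff[OF e[OF i] v(1)] by simp
      qed
    qed
    moreover have "repair_io n l H i M + tnum \<le> l * (n - 1)"
    proof -
      have le: "nonzero_cols (M * block l H j) + (if j \<in> T then 1 else 0) \<le> l" if j: "j \<in> {..<n} - {i}" for j
      proof (cases "j \<in> T")
        case True
        then obtain k where k: "k < l" "s j * e j k = qlin \<alpha> \<beta> (p j * e j k)"
          by (auto simp: T_def)
        \<comment> \<open>The \<open>k\<close>-th unit vector represents \<open>e j k\<close> and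
          also extracts column \<open>k\<close>.\<close>
        have "lin_comb (e j) l (vec_index (unit_vec l k)) = (\<Sum>i\<in>{k}. e j i)"
          unfolding lin_comb_def using k(1) by (intro sum.mono_neutral_cong_right) auto
        then have "(M * block l H j) *\<^sub>v unit_vec l k = 0\<^sub>v l"
          using MB0[of j "unit_vec l k"] j k by simp
        moreover have "(M * block l H j) *\<^sub>v unit_vec l k = col (M * block l H j) k"
          using MB[of j] k(1) by (intro eq_vecI) auto
        ultimately have "{a. a < dim_col (M * block l H j) \<and> col (M * block l H j) a \<noteq> 0\<^sub>v (dim_row (M * block l H j))}
            \<subseteq> {..<l} - {k}"
          using carrier_matD[OF MB[of j]] by auto
        then have "nonzero_cols (M * block l H j) \<le> card ({..<l} - {k})"
          unfolding nonzero_cols_def by (intro card_mono) auto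
        then show ?thesis
          using True k(1) by simp
      next
        case False
        then show ?thesis
          using repair_mats_nonzero_cols_le[OF H] by simp
      qed
      have "repair_io n l H i M + tnum \<le> repair_io n l H i M + card T"
        using card by (simp add: T_def)
      also have "card T = (\<Sum>j\<in>{..<n} - {i}. if j \<in> T then 1 else 0)"
        by (subst sum.inter_restrict[symmetric]) (auto simp: T_def intro!: arg_cong[of _ _ card])
      also have "repair_io n l H i M + \<dots> \<le> (\<Sum>j\<in>{..<n} - {i}. l)"
        unfolding repair_io_def sum.distrib[symmetric] by (intro sum_mono le)
      finally show ?thesis
        using i by (simp add: mult.commute)
    qed
    ultimately show ?thesis
      by blast
  qed
  moreover have "blocks_independent n l H"
    unfolding H_def by (rule blocks_independent_code_mat[OF b e ps distinct])
  moreover have "(CARD('a) - 1) * tnum = CARD('a) ^ l - 1"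
    using tnum_eq unfolding q_def .
  ultimately show ?thesis
    using code_of_parity_check[OF H _ n _ tn] by blast
qed

subsection \<open>Configurations of norm circles\<close>

text \<open>Proportional vectors cannot share a basis. The second alternative covers them and is
  good enough, because the equations to be met are invariant under scaling by
  \<open>'a\<close>.\<close>

lemma basis_containing_pair:
  assumes l: "2 \<le> l" and x: "x \<in> ext_field" "x \<noteq> 0" and y: "y \<in> ext_field" "y \<noteq> 0"
  shows "\<exists>b. independent l b \<and> b 0 = x \<and> (b 1 = y \<or> (\<exists>c. c \<noteq> 0 \<and> y = to_ac c * x))"
proof (cases "\<exists>c. y = to_ac c * x")
  case True
  then obtain c where c: "y = to_ac c * x"
    by blast
  moreover have "c \<noteq> 0"
    using c y by auto
  moreover obtain b where "independent l b" "\<forall>i<1. b i = x"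
    using basis_extending[OF independent_singleton[OF x]] l by auto
  ultimately show ?thesis
    by auto
next
  case False
  then obtain b where b: "independent l b" "\<forall>i<2. b i = (if i = 0 then x else y)"
    using basis_extending[OF independent_pair[OF x y(1)] l] by blast
  then have "b 0 = x" "b 1 = y"
    by auto
  then show ?thesis
    using b(1) by blast
qed

definition root_of :: "'a \<Rightarrow> 'a alg_closure" where
  "root_of c = (SOME \<beta>. \<beta> ^ tnum = to_ac c)"

lemma root_of: "root_of c ^ tnum = to_ac c"
  unfolding root_of_def using someI_ex[OF exists_norm] .

text \<open>A node on two circles needs a column in each of the two kernels. The vectors
  \<open>x\<close> and \<open>y\<close> go into one basis, or \<open>x\<close> serves for both
  circles when they are proportional.\<close>

lemma basis_meeting_circles:
  assumes l: "2 \<le> l" and c: "c1 \<noteq> 0" "c2 \<noteq> 0"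
    and z: "z \<in> norm_circle \<alpha>1 c1" "z \<in> norm_circle \<alpha>2 c2"
  shows "\<exists>b. independent l b \<and> (\<exists>k<l. z * b k = qlin \<alpha>1 (root_of c1) (b k)) \<and>
    (\<exists>k<l. z * b k = qlin \<alpha>2 (root_of c2) (b k))"
proof -
  obtain x where x: "x \<in> ext_field" "x \<noteq> 0" "z * x = qlin \<alpha>1 (root_of c1) x"
    using norm_circle_iff[OF c(1) root_of] z(1) by (auto simp: qlin_def)
  obtain y where y: "y \<in> ext_field" "y \<noteq> 0" "z * y = qlin \<alpha>2 (root_of c2) y"
    using norm_circle_iff[OF c(2) root_of] z(2) by (auto simp: qlin_def)
  obtain b where b: "independent l b" "b 0 = x" and b1: "b 1 = y \<or> (\<exists>c. c \<noteq> 0 \<and> y = to_ac c * x)"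
    using basis_containing_pair[OF l x(1,2) y(1,2)] by blast
  have "\<exists>k<l. z * b k = qlin \<alpha>2 (root_of c2) (b k)"
    using b1
  proof
    assume "b 1 = y"
    then show ?thesis
      using y(3) l by (intro exI[of _ 1]) auto
  next
    assume "\<exists>c. c \<noteq> 0 \<and> y = to_ac c * x"
    then obtain c where c: "c \<noteq> 0" "y = to_ac c * x"
      by blast
    have "to_ac c * (z * x) = to_ac c * qlin \<alpha>2 (root_of c2) x"
      using y(3) unfolding c(2) qlin_scale by (simp add: mult_ac)
    then have "z * x = qlin \<alpha>2 (root_of c2) x"
      using c(1) by simp
    then show ?thesis
      using b(2) l by (intro exI[of _ 0]) auto
  qed
  moreover have "\<exists>k<l. z * b k = qlin \<alpha>1 (root_of c1) (b k)"
    using x(3) b(2) l by (intro exI[of _ 0]) auto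
  ultimately show ?thesis
    using b(1) by blast
qed

text \<open>The nodes are \<open>n\<close> of the \<open>q ^ l + 1\<close> points of the projective
  line, among them all points of the circles. Node \<open>i\<close> is repaired by a circle that
  avoids it. No point lies on all of the at most three circles, so each lies on at most two and one
  basis handles both.\<close>

lemma exists_optimal_code_circles:
  assumes l: "2 \<le> l" and n: "3 \<le> n" "n \<le> q ^ l + 1"
    and \<Gamma>: "finite \<Gamma>" "card \<Gamma> \<le> 3" "\<And>\<alpha> c. (\<alpha>, c) \<in> \<Gamma> \<Longrightarrow> \<alpha> \<in> ext_field \<and> c \<noteq> 0"
    and avoid: "\<And>z. \<exists>(\<alpha>, c)\<in>\<Gamma>. z \<notin> norm_circle \<alpha> c"
    and card: "card (\<Union>(\<alpha>, c)\<in>\<Gamma>. norm_circle \<alpha> c) \<le> n"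
  shows "\<exists>C :: 'a vec set. mds_code_saving n l tnum C"
proof -
  let ?circ = "\<lambda>g. norm_circle (fst g) (snd g)"
  let ?f = "\<lambda>g. qlin (fst g) (root_of (snd g))"
  have avoid': "\<exists>g\<in>\<Gamma>. z \<notin> ?circ g" for z
    using avoid[of z] by force
  have \<Gamma>': "fst g \<in> ext_field" "snd g \<noteq> 0" "root_of (snd g) \<in> ext_field" if "g \<in> \<Gamma>" for g
    using \<Gamma>(3)[of "fst g" "snd g"] that in_ext_if_norm[OF _ root_of] by auto
  have basis: "\<exists>b. independent l b \<and> (\<forall>g\<in>\<Gamma>. z \<in> ?circ g \<longrightarrow> (\<exists>k<l. z * b k = ?f g (b k)))" for z
  proof (cases "\<exists>g\<in>\<Gamma>. z \<in> ?circ g")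
    case False
    then show ?thesis
      using basis_extending[of 1 "\<lambda>_. 1"] independent_singleton[of 1] ext_1 l by auto
  next
    case True
    then obtain g1 where g1: "g1 \<in> \<Gamma>" "z \<in> ?circ g1"
      by blast
    define S where "S = {g \<in> \<Gamma>. z \<in> ?circ g}"
    obtain g0 where "g0 \<in> \<Gamma>" "g0 \<notin> S"
      using avoid'[of z] by (auto simp: S_def)
    then have "card S < card \<Gamma>"
      using \<Gamma>(1) by (intro psubset_card_mono) (auto simp: S_def)
    then have "card (S - {g1}) \<le> 1"
      using \<Gamma>(1,2) g1 by (simp add: S_def card_Diff_singleton)
    moreover have "finite (S - {g1})"
      using \<Gamma>(1) by (simp add: S_def)
    \<comment> \<open>\<open>g2 = g1\<close> when no second circle passes through
      \<open>z\<close>.\<close>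
    ultimately obtain g2 where g2: "g2 \<in> S" "S \<subseteq> {g1, g2}"
    proof (cases "S - {g1} = {}")
      case True
      then show ?thesis
        using that[of g1] g1 by (auto simp: S_def)
    next
      case False
      then obtain g2 where "g2 \<in> S - {g1}"
        by blast
      then have "S - {g1} \<subseteq> {g2}"
        using \<open>card (S - {g1}) \<le> 1\<close> \<open>finite (S - {g1})\<close> by (metis card_le_Suc0_iff_eq One_nat_def insertI1 subsetI)
      then show ?thesis
        using that[of g2] \<open>g2 \<in> S - {g1}\<close> by blast
    qed
    have "g2 \<in> \<Gamma>" "z \<in> ?circ g2"
      using g2(1) by (auto simp: S_def)
    then obtain b where "independent l b" "\<exists>k<l. z * b k = ?f g1 (b k)" "\<exists>k<l. z * b k = ?f g2 (b k)"
      using basis_meeting_circles[OF l \<Gamma>'(2)[OF g1(1)] \<Gamma>'(2) g1(2)] by blast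
    then show ?thesis
      using g2(2) by (intro exI[of _ b]) (auto simp: S_def)
  qed
  then obtain B where B: "\<And>z. independent l (B z)"
      "\<And>z g. g \<in> \<Gamma> \<Longrightarrow> z \<in> ?circ g \<Longrightarrow> \<exists>k<l. z * B z k = ?f g (B z k)"
    by metis
  define U where "U = (\<Union>g\<in>\<Gamma>. ?circ g)"
  have "?circ g \<subseteq> ext_field" if "g \<in> \<Gamma>" for g
    using norm_circle_subset \<Gamma>'(1,2)[OF that] by blast
  then have U: "U \<subseteq> ext_field" "card U \<le> n"
    using card unfolding U_def by (blast, simp add: case_prod_beta)
  \<comment> \<open>The projective line: \<open>None\<close> is the point at infinity, with
    coordinates \<open>(0, 1)\<close>, and \<open>Some z\<close> has coordinates
    \<open>(1, z)\<close>.\<close>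
  define A where "A = insert None (Some ` ext_field)"
  have A: "finite A" "card A = q ^ l + 1"
    using card_ext by (simp_all add: A_def card_image)
  \<comment> \<open>The points of the circles are padded with arbitrary further points to exactly
    \<open>n\<close> nodes.\<close>
  have "\<exists>S. Some ` U \<subseteq> S \<and> S \<subseteq> A \<and> card S = n"
    using U n A by (intro exists_subset_between) (auto simp: A_def card_image)
  then obtain S where S: "Some ` U \<subseteq> S" "S \<subseteq> A" "card S = n"
    by blast
  have finS: "finite S"
    using S(2) A(1) by (rule finite_subset)
  obtain h where h: "bij_betw h {..<n} S"
    using ex_bij_betw_nat_finite[OF finS] S(3) by (auto simp: atLeast0LessThan)
  define p where "p j = (case h j of None \<Rightarrow> 0 | Some _ \<Rightarrow> (1 :: 'a alg_closure))" for j
  define s where "s j = (case h j of None \<Rightarrow> 1 | Some z \<Rightarrow> z)" for j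
  define e where "e j = B (s j)" for j
  have hA: "h j \<in> A" if "j < n" for j
    using that bij_betwE[OF h] S(2) by blast
  have ps: "p j \<in> ext_field \<and> s j \<in> ext_field" if "j < n" for j
    using hA[OF that] ext_0 ext_1 by (auto simp: p_def s_def A_def split: option.splits)
  have distinct: "p i * s j \<noteq> p j * s i" if "i < n" "j < n" "i \<noteq> j" for i j
  proof -
    have "h i \<noteq> h j"
      using that bij_betw_imp_inj_on[OF h] by (auto dest: inj_onD)
    then show ?thesis
      by (auto simp: p_def s_def split: option.splits)
  qed
  have "\<exists>\<alpha>\<in>ext_field. \<exists>\<beta>\<in>ext_field.
      (\<forall>x\<in>ext_field. s i * x = qlin \<alpha> \<beta> (p i * x) \<longrightarrow> x = 0) \<and>
      tnum \<le> card {j \<in> {..<n} - {i}. \<exists>k<l. s j * e j k = qlin \<alpha> \<beta> (p j * e j k)}" if i: "i < n" for i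
  proof -
    obtain g where g: "g \<in> \<Gamma>" "h i \<notin> Some ` ?circ g"
    proof (cases "h i")
      case None
      moreover obtain g where "g \<in> \<Gamma>"
        using avoid' by blast
      ultimately show ?thesis
        by (intro that[of g]) auto
    next
      case (Some z)
      moreover obtain g where "g \<in> \<Gamma>" "z \<notin> ?circ g"
        using avoid'[of z] by blast
      ultimately show ?thesis
        by (intro that[of g]) auto
    qed
    have iff: "z \<in> ?circ g \<longleftrightarrow> (\<exists>x\<in>ext_field. x \<noteq> 0 \<and> ?f g x = z * x)" for z
      using norm_circle_iff[OF \<Gamma>'(2)[OF g(1)] root_of] by (simp add: qlin_def)
    \<comment> \<open>At infinity the equation reads \<open>x = qlin \<alpha> \<beta> 0\<close>, so
      this line meets every graph only in the origin; elsewhere the circle criterion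
      decides.\<close>
    have "x = 0" if "x \<in> ext_field" "s i * x = ?f g (p i * x)" for x
    proof (cases "h i")
      case None
      then show ?thesis
        using that by (simp add: s_def p_def)
    next
      case (Some z)
      then have "z \<notin> ?circ g"
        using g(2) by auto
      then show ?thesis
        using that Some iff[of z] by (auto simp: s_def p_def)
    qed
    moreover have "tnum \<le> card {j \<in> {..<n} - {i}. \<exists>k<l. s j * e j k = ?f g (p j * e j k)}" (is "_ \<le> card ?T")
    proof -
      have "tnum = card (Some ` ?circ g)"
        using card_norm_circle(1)[OF \<Gamma>'(2)[OF g(1)]] by (simp add: card_image)
      also have "\<dots> \<le> card (h ` ?T)"
      proof (rule card_mono)
        show "Some ` ?circ g \<subseteq> h ` ?T"
        proof
          fix y assume y: "y \<in> Some ` ?circ g"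
          then obtain z where z: "y = Some z" "z \<in> ?circ g"
            by blast
          then have "y \<in> S"
            using S(1) g(1) by (auto simp: U_def)
          then obtain j where j: "j < n" "y = h j"
            using h by (auto simp: bij_betw_def)
          have "j \<noteq> i"
            using j(2) y g(2) by metis
          moreover have "h j = Some z"
            using j(2) z(1) by simp
          then have "p j = 1" "s j = z"
            by (simp_all add: p_def s_def)
          moreover obtain k where "k < l" "z * B z k = ?f g (B z k)"
            using B(2)[OF g(1) z(2)] by blast
          ultimately have "j \<in> ?T"
            using j(1) by (auto simp: e_def)
          then show "y \<in> h ` ?T"
            using j(2) by blast
        qed
      qed auto
      also have "\<dots> \<le> card ?T"
        by (rule card_image_le) auto
      finally show ?thesis .
    qed
    ultimately show ?thesis
      using \<Gamma>'[OF g(1)] by blast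
  qed
  then show ?thesis
    using exists_optimal_code[of n e p s] n(1) B(1) ps distinct by (auto simp: e_def)
qed

text \<open>Concentric circles with different norms are disjoint, and \<open>q \<ge> 3\<close>
  provides a nonzero norm other than \<open>1\<close>.\<close>

lemma exists_optimal_code_two_circles:
  assumes l: "2 \<le> l" and q: "3 \<le> q" and n: "2 * tnum \<le> n" "n \<le> q ^ l + 1"
  shows "\<exists>C :: 'a vec set. mds_code_saving n l tnum C"
proof -
  obtain c :: 'a where c: "c \<noteq> 0" "c \<noteq> 1"
    using exists_not_0_1 q by auto
  \<comment> \<open>Gives \<open>4 \<le> n\<close>, hence the required
    \<open>3 \<le> n\<close>.\<close>
  have "2 \<le> tnum"
  proof -
    have "(\<Sum>i\<in>{0, 1}. q ^ i) \<le> tnum"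
      unfolding tnum_def using l by (intro sum_mono2) auto
    then show ?thesis
      using q by simp
  qed
  show ?thesis
  proof (rule exists_optimal_code_circles[where \<Gamma> = "{(0, 1), (0, c)}"])
    show "card (\<Union>(\<alpha>, c)\<in>{(0, 1), (0, c)}. norm_circle \<alpha> c) \<le> n"
      using card_Un_le[of "norm_circle 0 1" "norm_circle 0 c"] card_norm_circle(1)[of 1 0]
        card_norm_circle(1)[OF c(1), of 0] n(1) by simp
    show "\<exists>(\<alpha>, c)\<in>{(0, 1), (0, c)}. z \<notin> norm_circle \<alpha> c" for z
      using c by (auto simp: norm_circle_def)
  qed (use l n c \<open>2 \<le> tnum\<close> ext_0 in auto)
qed

section \<open>Three circles over the fields with three and four elements\<close>

text \<open>On the ground field the norm is \<open>x ^ 4\<close>, which is \<open>0\<close> or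
  \<open>1\<close>. Circles of norm \<open>-1\<close> centred at \<open>0, 1, -1\<close> thus miss
  the ground field, and their union lies among the other \<open>9 - 3 = 6\<close> elements.\<close>

lemma exists_optimal_code_q3:
  assumes l: "l = 2" and q: "q = 3" and n: "6 \<le> n" "n \<le> q ^ l + 1"
  shows "\<exists>C :: 'a vec set. mds_code_saving n l tnum C"
proof -
  have three: "(3 :: 'a) = 0"
    using of_nat_card_field by (simp add: q)
  then have three': "(3 :: 'a alg_closure) = 0"
    by (metis to_ac_0 to_ac_numeral)
  have t: "tnum = 4"
    unfolding tnum_def by (simp add: l q numeral_2_eq_2)
  let ?\<Gamma> = "{(0, -1), (1, -1), (-1, -1)} :: ('a alg_closure \<times> 'a) set"
  show ?thesis
  proof (rule exists_optimal_code_circles[where \<Gamma> = ?\<Gamma>])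
    show "\<exists>(\<alpha>, c)\<in>?\<Gamma>. z \<notin> norm_circle \<alpha> c" for z
    proof (rule ccontr)
      assume "\<not> (\<exists>(\<alpha>, c)\<in>?\<Gamma>. z \<notin> norm_circle \<alpha> c)"
      then have "z ^ 4 = -1" "(z - 1) ^ 4 = -1" "(z + 1) ^ 4 = -1"
        by (auto simp: norm_circle_def t)
      then have "z ^ 4 + (z - 1) ^ 4 + (z + 1) ^ 4 = - 3"
        by simp
      \<comment> \<open>In characteristic three the sum is identically \<open>-1\<close>, while a
        common point would make it \<open>-3 = 0\<close>.\<close>
      moreover have "z ^ 4 + (z - 1) ^ 4 + (z + 1) ^ 4 = 3 * (z ^ 4 + 4 * z ^ 2 + 1) - 1"
        by (simp add: eval_nat_numeral algebra_simps)
      ultimately show False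
        by (simp add: three')
    qed
    have "norm_circle \<alpha> c \<subseteq> ext_field - range to_ac" if "(\<alpha>, c) \<in> ?\<Gamma>" for \<alpha> c
    proof -
      have c: "c = -1" and "\<exists>a. \<alpha> = to_ac a"
        using that by (auto intro: exI[of _ 0] exI[of _ 1] exI[of _ "-1"])
      then obtain a where a: "\<alpha> = to_ac a"
        by blast
      have "x ^ 4 \<noteq> -1" for x :: 'a
      proof
        assume x: "x ^ 4 = -1"
        then have "x \<noteq> 0"
          by auto
        then have "x ^ 2 = 1"
          using power_card_field_minus_1[of x] by (simp add: q)
        then have "x ^ 4 = 1"
          using power_mult[of x 2 2] by simp
        then have "(2 :: 'a) = 0"
          using x by (metis add.right_inverse one_add_one)
        have "(1 :: 'a) = 3 - 2"
          by simp
        then show False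
          using three \<open>2 = 0\<close> by simp
      qed
      then have "to_ac ((x - a) ^ 4) \<noteq> to_ac (-1)" for x
        by (simp only: to_ac_eq_iff not_False_eq_True)
      then have "to_ac x \<notin> norm_circle \<alpha> c" for x
        by (simp add: norm_circle_def t a c)
      moreover have "norm_circle \<alpha> c \<subseteq> ext_field"
        using c a by (intro norm_circle_subset) (auto intro: ext_to_ac)
      ultimately show ?thesis
        by blast
    qed
    then have "(\<Union>(\<alpha>, c)\<in>?\<Gamma>. norm_circle \<alpha> c) \<subseteq> ext_field - range to_ac"
      by blast
    then have "card (\<Union>(\<alpha>, c)\<in>?\<Gamma>. norm_circle \<alpha> c) \<le> card (ext_field - range to_ac)"
      using card_ext by (intro card_mono) auto
    also have "card (ext_field - range to_ac) = card ext_field - card (range (to_ac :: 'a \<Rightarrow> _))"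
      using ext_to_ac by (intro card_Diff_subset) auto
    also have "\<dots> = 6"
      unfolding card_ext(1) card_image[OF inj_to_ac] q_def[symmetric] by (simp add: l q)
    finally show "card (\<Union>(\<alpha>, c)\<in>?\<Gamma>. norm_circle \<alpha> c) \<le> n"
      using n by simp
    show "card ?\<Gamma> \<le> 3"
      using card_length[of "[(0, -1), (1, -1), (-1, -1)] :: ('a alg_closure \<times> 'a) list"] by simp
  qed (use l n ext_closed in auto)
qed

text \<open>For a primitive cube root of unity \<open>w\<close> with image \<open>W\<close>, the
  circles around \<open>0, 1, W\<close> with norms \<open>1, w, w ^ 2\<close> have no common point
  and pairwise share at least two, so at most \<open>3 * 5 - 6 = 9\<close> points are
  covered.\<close>

lemma exists_optimal_code_q4:
  assumes l: "l = 2" and q: "q = 4" and n: "9 \<le> n" "n \<le> q ^ l + 1"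
  shows "\<exists>C :: 'a vec set. mds_code_saving n l tnum C"
proof -
  have "(2 :: 'a) * 2 = 0"
    using of_nat_card_field by (simp add: q)
  then have two: "(2 :: 'a) = 0"
    using mult_eq_0_iff by blast
  then have two': "(2 :: 'a alg_closure) = 0"
    by (metis to_ac_0 to_ac_numeral)
  have t: "tnum = 5"
    unfolding tnum_def by (simp add: l q numeral_2_eq_2)
  obtain w :: 'a where w: "w \<noteq> 0" "w \<noteq> 1"
    using exists_not_0_1 q by auto
  have "w ^ 3 = 1"
    using power_card_field_minus_1[OF w(1)] by (simp add: q)
  then have "(w - 1) * (w ^ 2 + w + 1) = 0"
    by (simp add: eval_nat_numeral algebra_simps)
  then have "w ^ 2 + w + 1 = 0"
    using w(2) by simp
  then have "to_ac (w ^ 2 + w + 1) = to_ac 0"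
    by (rule arg_cong)
  define W where "W = to_ac w"
  have W: "W ^ 2 + W + 1 = 0"
    using \<open>to_ac (w ^ 2 + w + 1) = to_ac 0\<close> by (simp add: W_def)
  have W0: "W \<noteq> 0"
    using w by (simp add: W_def)
  define A B C where "A = norm_circle 0 1" and "B = norm_circle 1 w" and "C = norm_circle W (w ^ 2)"
  have inA: "z \<in> A \<longleftrightarrow> z ^ 5 = 1" and inB: "z \<in> B \<longleftrightarrow> (z - 1) ^ 5 = W"
    and inC: "z \<in> C \<longleftrightarrow> (z - W) ^ 5 = W ^ 2" for z
    by (simp_all add: A_def B_def C_def norm_circle_def t W_def)
  have fin: "finite A" "finite B" "finite C" and card: "card A = 5" "card B = 5" "card C = 5"
    using w by (simp_all add: A_def B_def C_def card_norm_circle t)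
  text \<open>The affine map \<open>\<sigma>\<close> permutes the three circles cyclically.\<close>
  define \<sigma> where "\<sigma> z = W ^ 2 * z + 1" for z
  have inj: "inj \<sigma>"
    using W0 by (auto simp: \<sigma>_def inj_def)
  have "W ^ 3 - 1 = (W - 1) * (W ^ 2 + W + 1)"
    by (simp add: eval_nat_numeral algebra_simps)
  then have W3: "W ^ 3 = 1"
    using W by simp
  have "(W ^ 2) ^ 5 = (W ^ 3) ^ 3 * W"
    by (simp add: eval_nat_numeral mult_ac)
  \<comment> \<open>\<open>W ^ 2\<close> has norm \<open>W\<close>, so \<open>\<sigma>\<close>
    multiplies norms of differences by \<open>W\<close> and the radii run through
    \<open>1, W, W ^ 2\<close>.\<close>
  then have W10: "(W ^ 2) ^ 5 = W"
    by (simp add: W3)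
  have W4: "W ^ 4 = W" "W ^ 5 = W ^ 2"
    using W3 by (simp_all add: eval_nat_numeral mult_ac)
  \<comment> \<open>The binomial coefficients of the fifth power are \<open>1, 1, 0, 0, 1, 1\<close>
    modulo two; the rest is an explicit multiple of \<open>2\<close>.\<close>
  have pow5: "(x - a) ^ 5 = x ^ 5 + x ^ 4 * a + x * a ^ 4 + a ^ 5" for x a :: "'a alg_closure"
  proof -
    have "(x - a) ^ 5 = x ^ 5 + x ^ 4 * a + x * a ^ 4 + a ^ 5
        + 2 * (5 * x ^ 3 * a ^ 2 + 2 * x * a ^ 4 - 3 * x ^ 4 * a - 5 * x ^ 2 * a ^ 3 - a ^ 5)"
      by (simp add: eval_nat_numeral algebra_simps)
    then show ?thesis
      by (simp add: two')
  qed
  have AB: "\<sigma> z \<in> B" if "z \<in> A" for z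
  proof -
    have "(\<sigma> z - 1) ^ 5 = (W ^ 2) ^ 5 * z ^ 5"
      by (simp add: \<sigma>_def power_mult_distrib)
    then show ?thesis
      using that unfolding inA inB W10 by simp
  qed
  have BC: "\<sigma> z \<in> C" if "z \<in> B" for z
  proof -
    \<comment> \<open>\<open>\<sigma>\<close> moves the centre \<open>1\<close> to
      \<open>W ^ 2 + 1\<close>, which is \<open>W\<close> in characteristic two.\<close>
    have "\<sigma> z - W = W ^ 2 * (z - 1) + ((W ^ 2 + W + 1) - 2 * W)"
      by (simp add: \<sigma>_def algebra_simps)
    then have "(\<sigma> z - W) ^ 5 = (W ^ 2) ^ 5 * (z - 1) ^ 5"
      by (simp add: W two' power_mult_distrib)
    then show ?thesis
      using that unfolding inB inC W10 by (simp add: power2_eq_square)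
  qed
  have CA: "\<sigma> z \<in> A" if "z \<in> C" for z
  proof -
    have "\<sigma> z = W ^ 2 * (z - W) + ((W ^ 3 - 1) + 2)"
      by (simp add: \<sigma>_def eval_nat_numeral algebra_simps)
    then have "\<sigma> z ^ 5 = (W ^ 2) ^ 5 * (z - W) ^ 5"
      by (simp add: W3 two' power_mult_distrib)
    then show ?thesis
      using that W3 unfolding inC inA W10 by (simp add: eval_nat_numeral)
  qed
  have disj: "A \<inter> B \<inter> C = {}"
  proof (rule ccontr)
    assume "A \<inter> B \<inter> C \<noteq> {}"
    then obtain z where z: "z ^ 5 = 1" "(z - 1) ^ 5 = W" "(z - W) ^ 5 = W ^ 2"
      using inA inB inC by blast
    \<comment> \<open>Comparing the equation of \<open>A\<close> with those of \<open>B\<close> and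
      \<open>C\<close> gives two conditions on \<open>z ^ 4 + z\<close>, which together force
      \<open>1 + W ^ 2 = 0\<close>, that is \<open>W = 0\<close>.\<close>
    have "z ^ 4 + z = W"
      using z(1,2) pow5[of z 1] two' by (simp add: algebra_simps)
    moreover have "1 + W * (z ^ 4 + z) = 0"
      using z(1,3) pow5[of z W] W4 by (simp add: algebra_simps power2_eq_square)
    ultimately have "1 + W ^ 2 = 0"
      by (simp add: power2_eq_square)
    moreover have "W = (W ^ 2 + W + 1) - (1 + W ^ 2)"
      by simp
    ultimately have "W = 0"
      by (simp add: W)
    then show False
      using W0 by simp
  qed
  \<comment> \<open>On \<open>A \<inter> B\<close> one has \<open>z ^ 5 = 1\<close> and
    \<open>z ^ 4 + z = W\<close>; multiplying the latter by \<open>z\<close> leaves this quadratic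
    in characteristic two.\<close>
  have "\<exists>z. poly [:1, W, 1:] z = 0"
    by (rule alg_closed_imp_poly_has_root) simp
  then obtain z where z: "z ^ 2 + W * z + 1 = 0"
    by (auto simp: algebra_simps power2_eq_square)
  have root_in: "y \<in> A \<inter> B" if y: "y ^ 2 + W * y + 1 = 0" for y
  proof -
    \<comment> \<open>Division of \<open>y ^ 4\<close> by the quadratic, with remainder
      \<open>y + W\<close> up to terms that vanish.\<close>
    have "y ^ 4 = (y ^ 2 + W * y + 1) * (y ^ 2 - W * y - 1 + W ^ 2) + 2 * (W * y - y + 1)
        - (W ^ 3 - 1) * y - (W ^ 2 + W + 1) + y + W"
      by (simp add: eval_nat_numeral algebra_simps)
    then have y4: "y ^ 4 = y + W"
      by (simp add: y W W3 two')
    have "y ^ 5 = y * y ^ 4"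
      by (simp add: eval_nat_numeral)
    also have "\<dots> = (y ^ 2 + W * y + 1) + 1 - 2"
      by (simp add: y4 power2_eq_square algebra_simps)
    finally have y5: "y ^ 5 = 1"
      by (simp add: y two')
    have "(y - 1) ^ 5 = W + 2 * (y + 1)"
      unfolding pow5 y4 y5 by (simp add: algebra_simps)
    then have "(y - 1) ^ 5 = W"
      by (simp add: two')
    with y5 show ?thesis
      by (simp add: inA inB)
  qed
  \<comment> \<open>The roots sum to \<open>-W = W\<close>, so the second root is
    \<open>z + W\<close>, which differs from \<open>z\<close>.\<close>
  have "(z + W) ^ 2 + W * (z + W) + 1 = (z ^ 2 + W * z + 1) + 2 * (W * z + W ^ 2)"
    by (simp add: power2_eq_square algebra_simps)
  then have "(z + W) ^ 2 + W * (z + W) + 1 = 0"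
    by (simp add: z two')
  then have AiB: "{z, z + W} \<subseteq> A \<inter> B"
    using root_in z by blast
  have c2: "card {z, z + W} = 2"
    using W0 by simp
  \<comment> \<open>The injective map \<open>\<sigma>\<close> carries the two points of
    \<open>A \<inter> B\<close> to the other two intersections.\<close>
  have "\<sigma> ` {z, z + W} \<subseteq> B \<inter> C"
    using AiB AB BC by blast
  moreover from this have "\<sigma> ` \<sigma> ` {z, z + W} \<subseteq> C \<inter> A"
    using BC CA by blast
  moreover have "card (\<sigma> ` {z, z + W}) = 2" "card (\<sigma> ` \<sigma> ` {z, z + W}) = 2"
    using c2 inj by (simp_all only: card_image inj_on_subset[OF inj subset_UNIV])
  ultimately have meet: "2 \<le> card (A \<inter> B)" "2 \<le> card (B \<inter> C)" "2 \<le> card (C \<inter> A)"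
    using AiB c2 fin by (metis card_mono finite_Int)+
  let ?\<Gamma> = "{(0, 1), (1, w), (W, w ^ 2)} :: ('a alg_closure \<times> 'a) set"
  show ?thesis
  proof (rule exists_optimal_code_circles[where \<Gamma> = ?\<Gamma>])
    show "\<exists>(\<alpha>, c)\<in>?\<Gamma>. z \<notin> norm_circle \<alpha> c" for z
      using disj by (auto simp: A_def B_def C_def)
    have "(\<Union>(\<alpha>, c)\<in>?\<Gamma>. norm_circle \<alpha> c) = A \<union> B \<union> C"
      by (auto simp: A_def B_def C_def)
    then show "card (\<Union>(\<alpha>, c)\<in>?\<Gamma>. norm_circle \<alpha> c) \<le> n"
      using card_three_Un_le[OF fin card meet disj] n by simp
    show "card ?\<Gamma> \<le> 3"
      using card_length[of "[(0, 1), (1, w), (W, w ^ 2)]"] by simp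
  qed (use l n w ext_closed in \<open>auto simp: W_def\<close>)
qed

end

theorem theorem1p3:
  fixes q l n :: nat
  assumes "CARD('a::{finite, field}) = q"
    and "q \<ge> 3"
    and "l \<ge> 2"
    and "min (2 * t_num l q) (3 * t_num l q - 6) \<le> real n"
    and "n \<le> q ^ l + 1"
  shows "\<exists>C :: 'a vec set.
      linear_array_code n (n - 2) l C \<and> mds n (n - 2) l C \<and>
      beta_avg n (n - 2) l C = real l * (real n - 1) - t_num l q \<and>
      real (beta_max n (n - 2) l C) = real l * (real n - 1) - t_num l q \<and>
      gamma_avg n (n - 2) l C = real l * (real n - 1) - t_num l q \<and>
      real (gamma_max n (n - 2) l C) = real l * (real n - 1) - t_num l q"
proof -
  interpret finite_field_extension "TYPE('a)" q l
    using assms by unfold_locales auto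
  have t: "t_num l q = real tnum"
  proof -
    have "real (q - 1) * real tnum = real (q ^ l - 1)"
      using tnum_eq by (metis of_nat_mult)
    then show ?thesis
      using assms(2) by (simp add: t_num_def of_nat_diff field_simps)
  qed
  show ?thesis
  proof (cases "2 * tnum \<le> n")
    case True
    then show ?thesis
      unfolding t mds_code_saving_def[symmetric]
      using exists_optimal_code_two_circles assms by blast
  next
    case False
    \<comment> \<open>Here \<open>3 t - 6 \<le> n < 2 t\<close>, so \<open>t < 6\<close>, whereas
      \<open>l \<ge> 3\<close> would give \<open>t \<ge> 1 + 3 + 9\<close>. For
      \<open>l = 2\<close>, where \<open>t = q + 1\<close>, only \<open>q = 3\<close> and
      \<open>q = 4\<close> remain.\<close>
    then have n: "3 * tnum \<le> n + 6" "n < 2 * tnum"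
      using assms(4) unfolding t by linarith+
    have "l = 2"
    proof (rule ccontr)
      assume "l \<noteq> 2"
      then have "(\<Sum>i\<in>{0, 1, 2}. q ^ i) \<le> tnum"
        unfolding tnum_def using assms(3) by (intro sum_mono2) auto
      moreover have "3 ^ 2 \<le> q ^ 2"
        using assms(2) by (intro power_mono) auto
      ultimately show False
        using n by simp
    qed
    then have "tnum = q + 1"
      unfolding tnum_def by (simp add: numeral_2_eq_2)
    then have "q = 3 \<and> 6 \<le> n \<or> q = 4 \<and> 9 \<le> n"
      using n assms(2) by linarith
    then show ?thesis
      unfolding t mds_code_saving_def[symmetric]
      using exists_optimal_code_q3 exists_optimal_code_q4 \<open>l = 2\<close> assms(5) by blast
  qed
qed

end
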